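(* Let $\Bbbk^G{}^\tau\#_{\sigma}\Bbbk F$ be a coquasitriangular Hopf algebra. Let $f\in F$, and let $V=\operatorname{span}\{v^{(1)},\dots,v^{(m)}\}$ and $W=\operatorname{span}\{w^{(1)},\dots,w^{(n)}\}$ be simple right comodules (with the displayed spanning sets as bases) over the coalgebras $\Bbbk^{G_f}_{\tau_f}$ and $\Bbbk^G$ respectively, with coactions $$\rho(v^{(i)})=\sum_{l=1}^m v^{(l)}\otimes\Big(\sum_{g\in G_f}a_{li}^g\,p_g\Big),\qquad \rho(w^{(j)})=\sum_{k=1}^n w^{(k)}\otimes\Big(\sum_{h\in G}b_{kj}^h\,p_h\Big)$$ for $1\le i\le m$, $1\le j\le n$, where $a_{li}^g,b_{kj}^h\in\Bbbk$. Then for all $g\in G_f$ and $z\in T_f$, $$\sum_{i=1}^m\sum_{j=1}^n a_{ii}^g\,b_{jj}^{(z^{-1}gz)\triangleleft(z^{-1}\triangleright f)}=\sum_{i=1}^m\sum_{j=1}^n a_{ii}^g\,b_{jj}^{z^{-1}gz}.$$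
   Context: $\Bbbk$ is an algebraically closed field of characteristic zero, $G$ is a finite group and $F$ is an arbitrary group. $(F,G,\triangleleft,\triangleright)$ is a matched pair of groups: $\triangleleft:G\times F\to G$ is a right action of $F$ on the set $G$ and $\triangleright:G\times F\to F$ is a left action of $G$ on the set $F$, such that $g\triangleright(ff')=(g\triangleright f)((g\triangleleft f)\triangleright f')$ and $(gg')\triangleleft f=(g\triangleleft(g'\triangleright f))(g'\triangleleft f)$ for all $g,g'\in G$, $f,f'\in F$. The maps $\sigma:G\times F\times F\to\Bbbk^\times$ and $\tau:G\times G\times F\to\Bbbk^\times$ satisfy, for all $g,g',g''\in G$, $f,f',f''\in F$: $\sigma(g;1_F,f)=\sigma(g;f,1_F)=\sigma(1_G;f,f')=1$; $\sigma(g\triangleleft f;f',f'')\sigma(g;f,f'f'')=\sigma(g;f,f')\sigma(g;ff',f'')$; $\tau(1_G,g;f)=\tau(g,1_G;f)=\tau(g,g';1_F)=1$; $\tau(g,g';g''\triangleright f)\tau(gg',g'';f)=\tau(g,g'g'';f)\tau(g',g'';f)$; $\sigma(gg';f,f')\tau(g,g';ff')=\sigma(g;g'\triangleright f,(g'\triangleleft f)\triangleright f')\,\sigma(g';f,f')\,\tau(g,g';f)\,\tau(g\triangleleft(g'\triangleright f),g'\triangleleft f;f')$. The Hopf algebra $\Bbbk^G{}^\tau\#_{\sigma}\Bbbk F$ is the vector space $\Bbbk^G\otimes\Bbbk F$ with basis $p_g\# f:=p_g\otimes f$ ($g\in G,f\in F$; $\{p_g\}$ is the basis of $\Bbbk^G$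 dual to $G\subset\Bbbk G$), multiplication $(p_g\# f)(p_{g'}\# f')=\delta_{g\triangleleft f,g'}\sigma(g;f,f')\,p_g\# ff'$, comultiplication $\Delta(p_g\# f)=\sum_{x\in G}\tau(gx^{-1},x;f)\,(p_{gx^{-1}}\#(x\triangleright f))\otimes(p_x\# f)$, unit $\sum_{g\in G}p_g\#1_F$, counit $\varepsilon(p_g\# f)=\delta_{g,1_G}$, and antipode $S(p_g\# f)=\sigma(g^{-1};g\triangleright f,(g\triangleright f)^{-1})^{-1}\tau(g^{-1},g;f)^{-1}p_{(g\triangleleft f)^{-1}}\#(g\triangleright f)^{-1}$. A Hopf algebra $H$ is coquasitriangular if there is a convolution-invertible bilinear form $R:H\otimes H\to\Bbbk$ with $R(a,bc)=\sum R(a_{(1)},c)R(a_{(2)},b)$, $R(ab,c)=\sum R(a,c_{(1)})R(b,c_{(2)})$ and $\sum R(a_{(1)},b_{(1)})a_{(2)}b_{(2)}=\sum b_{(1)}a_{(1)}R(a_{(2)},b_{(2)})$ for all $a,b,c\in H$. For $f\in F$: $G_f=\{g\in G\mid g\triangleright f=f\}$; $T_f$ is a complete set of right coset representatives of $G_f$ in $G$ (every $x\in G$ is uniquely $x=g_xz_x$ with $g_x\in G_f$, $z_x\in T_f$), with $1_G\in T_f$. $\Bbbk^{G_f}_{\tau_f}$ is the vector space $\Bbbk^{G_f}$ with the coalgebra structure $\Delta(p_g)=\sum_{x\in G_f}\tau(gx^{-1},x;f)\,p_{gx^{-1}}\otimes p_x$, $\varepsilon(p_g)=\delta_{g,1_G}$.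 $\Bbbk^G$ carries its usual coalgebra structure $\Delta(p_g)=\sum_{x\in G}p_{gx^{-1}}\otimes p_x$. *)

theory Defs
  imports
    "HOL-Algebra.Group_Action"
    "HOL-Computational_Algebra.Polynomial"
    "HOL-Library.Poly_Mapping"
begin

section \<open>Vector spaces with a basis, and tensor products with them\<close>

text \<open>
  The vector space over \<open>'k\<close> with basis \<open>B :: 'b set\<close> is the set \<open>free_space B\<close> of finitely
  supported functions \<open>'b \<Rightarrow>\<^sub>0 'k\<close> with support in \<open>B\<close>. If \<open>V\<close> is a vector space with scalar
  multiplication \<open>s :: 'k \<Rightarrow> 'v \<Rightarrow> 'v\<close>, then the tensor product of \<open>V\<close> with \<open>free_space B\<close>
  is the direct sum of copies of \<open>V\<close> indexed by \<open>B\<close>, and is rendered as the set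
  \<open>tensor_space V B\<close> of finitely supported functions \<open>'b \<Rightarrow>\<^sub>0 'v\<close>: the function \<open>t\<close> stands for
  the sum over \<open>y\<close> of \<open>lookup t y \<otimes> y\<close>. Taking \<open>V = free_space B\<close>, elements of the
  tensor square have type \<open>'b \<Rightarrow>\<^sub>0 'b \<Rightarrow>\<^sub>0 'k\<close>, where the argument applied first is the
  basis vector of the right tensor factor.
\<close>

definition free_space :: "'b set \<Rightarrow> ('b \<Rightarrow>\<^sub>0 'k::zero) set" where
  "free_space B = {a. Poly_Mapping.keys a \<subseteq> B}"

definition tensor_space :: "'v set \<Rightarrow> 'b set \<Rightarrow> ('b \<Rightarrow>\<^sub>0 'v::zero) set" where
  "tensor_space V B = {t. Poly_Mapping.keys t \<subseteq> B \<and> (\<forall>y. Poly_Mapping.lookup t y \<in> V)}"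

abbreviation basis_vec :: "'b \<Rightarrow> ('b \<Rightarrow>\<^sub>0 'k::zero_neq_one)" where
  "basis_vec b \<equiv> Poly_Mapping.single b 1"

definition pscale :: "('k \<Rightarrow> 'v \<Rightarrow> 'v) \<Rightarrow> 'k \<Rightarrow> ('b \<Rightarrow>\<^sub>0 'v::zero) \<Rightarrow> ('b \<Rightarrow>\<^sub>0 'v)" where
  "pscale s c t = Poly_Mapping.map (s c) t"

text \<open>Scalar multiplication on \<open>free_space B\<close>, and on its tensor square.\<close>

abbreviation scale1 :: "'k::field \<Rightarrow> ('b \<Rightarrow>\<^sub>0 'k) \<Rightarrow> ('b \<Rightarrow>\<^sub>0 'k)" where
  "scale1 \<equiv> pscale (*)"

abbreviation scale2 :: "'k::field \<Rightarrow> ('b \<Rightarrow>\<^sub>0 'c \<Rightarrow>\<^sub>0 'k) \<Rightarrow> ('b \<Rightarrow>\<^sub>0 'c \<Rightarrow>\<^sub>0 'k)" where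
  "scale2 \<equiv> pscale (pscale (*))"

definition tensor :: "('k \<Rightarrow> 'v \<Rightarrow> 'v) \<Rightarrow> 'v \<Rightarrow> ('b \<Rightarrow>\<^sub>0 'k::zero) \<Rightarrow> ('b \<Rightarrow>\<^sub>0 'v::zero)" where
  "tensor s v a = Poly_Mapping.map (\<lambda>c. s c v) a"

text \<open>
  For \<open>\<phi>\<close> bilinear, \<open>sweedler t \<phi>\<close> is the value at \<open>t\<close> of the linear map induced by \<open>\<phi>\<close> on
  the tensor product. So \<open>sweedler (\<Delta> a) (\<lambda>a1 a2. \<phi> a1 a2)\<close> renders the sum of
  \<open>\<phi>(a\<^sub>(\<^sub>1\<^sub>), a\<^sub>(\<^sub>2\<^sub>))\<close>.
\<close>

definition sweedler ::
  "('b \<Rightarrow>\<^sub>0 'v::zero) \<Rightarrow> ('v \<Rightarrow> ('b \<Rightarrow>\<^sub>0 'k::zero_neq_one) \<Rightarrow> 'w::comm_monoid_add) \<Rightarrow> 'w" where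
  "sweedler t \<phi> = (\<Sum>y\<in>Poly_Mapping.keys t. \<phi> (Poly_Mapping.lookup t y) (basis_vec y))"

definition linear_ext ::
  "('k \<Rightarrow> 'v \<Rightarrow> 'v) \<Rightarrow> ('b \<Rightarrow> 'v) \<Rightarrow> ('b \<Rightarrow>\<^sub>0 'k::zero) \<Rightarrow> 'v::comm_monoid_add" where
  "linear_ext s \<phi> a = (\<Sum>x\<in>Poly_Mapping.keys a. s (Poly_Mapping.lookup a x) (\<phi> x))"

definition linear_on ::
  "'v::plus set \<Rightarrow> ('k \<Rightarrow> 'v \<Rightarrow> 'v) \<Rightarrow> ('k \<Rightarrow> 'w \<Rightarrow> 'w) \<Rightarrow> ('v \<Rightarrow> 'w::plus) \<Rightarrow> bool" where
  "linear_on V s s' f \<longleftrightarrow>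
     (\<forall>x\<in>V. \<forall>y\<in>V. f (x + y) = f x + f y) \<and> (\<forall>c. \<forall>x\<in>V. f (s c x) = s' c (f x))"

definition bilinear_on ::
  "'v::plus set \<Rightarrow> ('k \<Rightarrow> 'v \<Rightarrow> 'v) \<Rightarrow> ('k \<Rightarrow> 'w \<Rightarrow> 'w) \<Rightarrow> ('v \<Rightarrow> 'v \<Rightarrow> 'w::plus) \<Rightarrow> bool" where
  "bilinear_on V s s' \<beta> \<longleftrightarrow>
     (\<forall>x\<in>V. linear_on V s s' (\<beta> x)) \<and> (\<forall>y\<in>V. linear_on V s s' (\<lambda>x. \<beta> x y))"


section \<open>Coalgebras and their right comodules\<close>

record (overloaded) ('b, 'k) coalg =
  cbasis :: "'b set"
  comul :: "('b \<Rightarrow>\<^sub>0 'k) \<Rightarrow> ('b \<Rightarrow>\<^sub>0 'b \<Rightarrow>\<^sub>0 'k)"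
  counit :: "('b \<Rightarrow>\<^sub>0 'k) \<Rightarrow> 'k"

abbreviation cspace :: "('b, 'k::field, 'm) coalg_scheme \<Rightarrow> ('b \<Rightarrow>\<^sub>0 'k) set" where
  "cspace C \<equiv> free_space (cbasis C)"

definition coalgebra :: "('b, 'k::field, 'm) coalg_scheme \<Rightarrow> bool" where
  "coalgebra C \<longleftrightarrow>
     linear_on (cspace C) scale1 scale2 (comul C) \<and>
     (\<forall>a\<in>cspace C. comul C a \<in> tensor_space (cspace C) (cbasis C)) \<and>
     linear_on (cspace C) scale1 (*) (counit C) \<and>
     (\<forall>a\<in>cspace C.
        sweedler (comul C a) (\<lambda>a1 a2. tensor scale2 (comul C a1) a2) =
        sweedler (comul C a) (\<lambda>a1 a2. sweedler (comul C a2)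
          (\<lambda>a2' a2''. tensor scale2 (tensor scale1 a1 a2') a2''))) \<and>
     (\<forall>a\<in>cspace C.
        sweedler (comul C a) (\<lambda>a1 a2. scale1 (counit C a1) a2) = a \<and>
        sweedler (comul C a) (\<lambda>a1 a2. scale1 (counit C a2) a1) = a)"

text \<open>The comodule is a subspace \<open>V\<close> of an ambient vector space with scalar multiplication \<open>s\<close>.\<close>

definition right_comodule ::
  "('b, 'k::field, 'm) coalg_scheme \<Rightarrow> ('k \<Rightarrow> 'v \<Rightarrow> 'v) \<Rightarrow> 'v::ab_group_add set \<Rightarrow>
     ('v \<Rightarrow> ('b \<Rightarrow>\<^sub>0 'v)) \<Rightarrow> bool" where
  "right_comodule C s V \<rho> \<longleftrightarrow>
     coalgebra C \<and> vector_space s \<and> module.subspace s V \<and>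
     linear_on V s (pscale s) \<rho> \<and>
     (\<forall>v\<in>V. \<rho> v \<in> tensor_space V (cbasis C)) \<and>
     (\<forall>v\<in>V.
        sweedler (\<rho> v) (\<lambda>v0 v1. tensor (pscale s) (\<rho> v0) (v1 :: 'b \<Rightarrow>\<^sub>0 'k)) =
        sweedler (\<rho> v) (\<lambda>v0 v1. sweedler (comul C v1)
          (\<lambda>v1' v1''. tensor (pscale s) (tensor s v0 v1') v1''))) \<and>
     (\<forall>v\<in>V. sweedler (\<rho> v) (\<lambda>v0 v1. s (counit C v1) v0) = v)"

definition simple_right_comodule ::
  "('b, 'k::field, 'm) coalg_scheme \<Rightarrow> ('k \<Rightarrow> 'v \<Rightarrow> 'v) \<Rightarrow> 'v::ab_group_add set \<Rightarrow>
     ('v \<Rightarrow> ('b \<Rightarrow>\<^sub>0 'v)) \<Rightarrow> bool" where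
  "simple_right_comodule C s V \<rho> \<longleftrightarrow>
     right_comodule C s V \<rho> \<and> V \<noteq> {0} \<and>
     (\<forall>U. U \<subseteq> V \<and> module.subspace s U \<and> (\<forall>u\<in>U. \<rho> u \<in> tensor_space U (cbasis C))
        \<longrightarrow> U = {0} \<or> U = V)"


section \<open>Coquasitriangular Hopf algebras\<close>

record (overloaded) ('b, 'k) hopf = "('b, 'k) coalg" +
  hmul :: "('b \<Rightarrow>\<^sub>0 'k) \<Rightarrow> ('b \<Rightarrow>\<^sub>0 'k) \<Rightarrow> ('b \<Rightarrow>\<^sub>0 'k)"
  hunit :: "'b \<Rightarrow>\<^sub>0 'k"
  antipode :: "('b \<Rightarrow>\<^sub>0 'k) \<Rightarrow> ('b \<Rightarrow>\<^sub>0 'k)"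

definition hopf_algebra :: "('b, 'k::field, 'm) hopf_scheme \<Rightarrow> bool" where
  "hopf_algebra H \<longleftrightarrow>
     coalgebra H \<and>
     bilinear_on (cspace H) scale1 scale1 (hmul H) \<and>
     (\<forall>a\<in>cspace H. \<forall>b\<in>cspace H. hmul H a b \<in> cspace H) \<and>
     hunit H \<in> cspace H \<and>
     (\<forall>a\<in>cspace H. \<forall>b\<in>cspace H. \<forall>c\<in>cspace H.
        hmul H (hmul H a b) c = hmul H a (hmul H b c)) \<and>
     (\<forall>a\<in>cspace H. hmul H (hunit H) a = a \<and> hmul H a (hunit H) = a) \<and>
     (\<forall>a\<in>cspace H. \<forall>b\<in>cspace H.
        comul H (hmul H a b) =
        sweedler (comul H a) (\<lambda>a1 a2. sweedler (comul H b)
          (\<lambda>b1 b2. tensor scale1 (hmul H a1 b1) (hmul H a2 b2)))) \<and>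
     comul H (hunit H) = tensor scale1 (hunit H) (hunit H) \<and>
     (\<forall>a\<in>cspace H. \<forall>b\<in>cspace H. counit H (hmul H a b) = counit H a * counit H b) \<and>
     counit H (hunit H) = 1 \<and>
     linear_on (cspace H) scale1 scale1 (antipode H) \<and>
     (\<forall>a\<in>cspace H. antipode H a \<in> cspace H) \<and>
     (\<forall>a\<in>cspace H.
        sweedler (comul H a) (\<lambda>a1 a2. hmul H (antipode H a1) a2) = scale1 (counit H a) (hunit H) \<and>
        sweedler (comul H a) (\<lambda>a1 a2. hmul H a1 (antipode H a2)) = scale1 (counit H a) (hunit H))"

definition bilinear_form ::
  "('b, 'k::field, 'm) hopf_scheme \<Rightarrow> (('b \<Rightarrow>\<^sub>0 'k) \<Rightarrow> ('b \<Rightarrow>\<^sub>0 'k) \<Rightarrow> 'k) \<Rightarrow> bool" where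
  "bilinear_form H R \<longleftrightarrow> bilinear_on (cspace H) scale1 (*) R"

definition convolution ::
  "('b, 'k::field, 'm) hopf_scheme \<Rightarrow> (('b \<Rightarrow>\<^sub>0 'k) \<Rightarrow> ('b \<Rightarrow>\<^sub>0 'k) \<Rightarrow> 'k) \<Rightarrow>
     (('b \<Rightarrow>\<^sub>0 'k) \<Rightarrow> ('b \<Rightarrow>\<^sub>0 'k) \<Rightarrow> 'k) \<Rightarrow> ('b \<Rightarrow>\<^sub>0 'k) \<Rightarrow> ('b \<Rightarrow>\<^sub>0 'k) \<Rightarrow> 'k" where
  "convolution H P Q a b =
     sweedler (comul H a) (\<lambda>a1 a2. sweedler (comul H b) (\<lambda>b1 b2. P a1 b1 * Q a2 b2))"

definition convolution_invertible ::
  "('b, 'k::field, 'm) hopf_scheme \<Rightarrow> (('b \<Rightarrow>\<^sub>0 'k) \<Rightarrow> ('b \<Rightarrow>\<^sub>0 'k) \<Rightarrow> 'k) \<Rightarrow> bool" where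
  "convolution_invertible H R \<longleftrightarrow>
     (\<exists>Q. bilinear_form H Q \<and>
        (\<forall>a\<in>cspace H. \<forall>b\<in>cspace H.
           convolution H R Q a b = counit H a * counit H b \<and>
           convolution H Q R a b = counit H a * counit H b))"

definition coquasitriangular :: "('b, 'k::field, 'm) hopf_scheme \<Rightarrow> bool" where
  "coquasitriangular H \<longleftrightarrow>
     hopf_algebra H \<and>
     (\<exists>R. bilinear_form H R \<and> convolution_invertible H R \<and>
        (\<forall>a\<in>cspace H. \<forall>b\<in>cspace H. \<forall>c\<in>cspace H.
           R a (hmul H b c) = sweedler (comul H a) (\<lambda>a1 a2. R a1 c * R a2 b) \<and>
           R (hmul H a b) c = sweedler (comul H c) (\<lambda>c1 c2. R a c1 * R b c2)) \<and>
        (\<forall>a\<in>cspace H. \<forall>b\<in>cspace H.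
           sweedler (comul H a) (\<lambda>a1 a2. sweedler (comul H b)
             (\<lambda>b1 b2. scale1 (R a1 b1) (hmul H a2 b2))) =
           sweedler (comul H a) (\<lambda>a1 a2. sweedler (comul H b)
             (\<lambda>b1 b2. scale1 (R a2 b2) (hmul H b1 a1)))))"


section \<open>Matched pairs of groups and the associated bismash products\<close>

locale matched_pair = G: group G + F: group F
  for G :: "('g, 'm) monoid_scheme" and F :: "('f, 'n) monoid_scheme" +
  fixes ract :: "'g \<Rightarrow> 'f \<Rightarrow> 'g" (infixl "\<triangleleft>" 75)
    and lact :: "'g \<Rightarrow> 'f \<Rightarrow> 'f" (infixr "\<triangleright>" 75)
  assumes ract_closed: "g \<in> carrier G \<Longrightarrow> f \<in> carrier F \<Longrightarrow> g \<triangleleft> f \<in> carrier G"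
    and ract_one: "g \<in> carrier G \<Longrightarrow> g \<triangleleft> \<one>\<^bsub>F\<^esub> = g"
    and ract_mult: "g \<in> carrier G \<Longrightarrow> f \<in> carrier F \<Longrightarrow> f' \<in> carrier F \<Longrightarrow>
      g \<triangleleft> (f \<otimes>\<^bsub>F\<^esub> f') = (g \<triangleleft> f) \<triangleleft> f'"
    and lact_closed: "g \<in> carrier G \<Longrightarrow> f \<in> carrier F \<Longrightarrow> g \<triangleright> f \<in> carrier F"
    and lact_one: "f \<in> carrier F \<Longrightarrow> \<one>\<^bsub>G\<^esub> \<triangleright> f = f"
    and lact_mult: "g \<in> carrier G \<Longrightarrow> g' \<in> carrier G \<Longrightarrow> f \<in> carrier F \<Longrightarrow>
      (g \<otimes>\<^bsub>G\<^esub> g') \<triangleright> f = g \<triangleright> (g' \<triangleright> f)"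
    and lact_prod: "g \<in> carrier G \<Longrightarrow> f \<in> carrier F \<Longrightarrow> f' \<in> carrier F \<Longrightarrow>
      g \<triangleright> (f \<otimes>\<^bsub>F\<^esub> f') = (g \<triangleright> f) \<otimes>\<^bsub>F\<^esub> ((g \<triangleleft> f) \<triangleright> f')"
    and ract_prod: "g \<in> carrier G \<Longrightarrow> g' \<in> carrier G \<Longrightarrow> f \<in> carrier F \<Longrightarrow>
      (g \<otimes>\<^bsub>G\<^esub> g') \<triangleleft> f = (g \<triangleleft> (g' \<triangleright> f)) \<otimes>\<^bsub>G\<^esub> (g' \<triangleleft> f)"

locale matched_pair_cocycles = matched_pair G F ract lact
  for G :: "('g, 'm) monoid_scheme" and F :: "('f, 'n) monoid_scheme"
    and ract :: "'g \<Rightarrow> 'f \<Rightarrow> 'g" (infixl "\<triangleleft>" 75)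
    and lact :: "'g \<Rightarrow> 'f \<Rightarrow> 'f" (infixr "\<triangleright>" 75) +
  fixes \<sigma> :: "'g \<Rightarrow> 'f \<Rightarrow> 'f \<Rightarrow> 'k::field"
    and \<tau> :: "'g \<Rightarrow> 'g \<Rightarrow> 'f \<Rightarrow> 'k"
  assumes sigma_nonzero: "g \<in> carrier G \<Longrightarrow> f \<in> carrier F \<Longrightarrow> f' \<in> carrier F \<Longrightarrow> \<sigma> g f f' \<noteq> 0"
    and tau_nonzero: "g \<in> carrier G \<Longrightarrow> g' \<in> carrier G \<Longrightarrow> f \<in> carrier F \<Longrightarrow> \<tau> g g' f \<noteq> 0"
    and sigma_one1: "g \<in> carrier G \<Longrightarrow> f \<in> carrier F \<Longrightarrow> \<sigma> g \<one>\<^bsub>F\<^esub> f = 1"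
    and sigma_one2: "g \<in> carrier G \<Longrightarrow> f \<in> carrier F \<Longrightarrow> \<sigma> g f \<one>\<^bsub>F\<^esub> = 1"
    and sigma_one3: "f \<in> carrier F \<Longrightarrow> f' \<in> carrier F \<Longrightarrow> \<sigma> \<one>\<^bsub>G\<^esub> f f' = 1"
    and sigma_cocycle: "g \<in> carrier G \<Longrightarrow> f \<in> carrier F \<Longrightarrow> f' \<in> carrier F \<Longrightarrow> f'' \<in> carrier F \<Longrightarrow>
      \<sigma> (g \<triangleleft> f) f' f'' * \<sigma> g f (f' \<otimes>\<^bsub>F\<^esub> f'') = \<sigma> g f f' * \<sigma> g (f \<otimes>\<^bsub>F\<^esub> f') f''"
    and tau_one1: "g \<in> carrier G \<Longrightarrow> f \<in> carrier F \<Longrightarrow> \<tau> \<one>\<^bsub>G\<^esub> g f = 1"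
    and tau_one2: "g \<in> carrier G \<Longrightarrow> f \<in> carrier F \<Longrightarrow> \<tau> g \<one>\<^bsub>G\<^esub> f = 1"
    and tau_one3: "g \<in> carrier G \<Longrightarrow> g' \<in> carrier G \<Longrightarrow> \<tau> g g' \<one>\<^bsub>F\<^esub> = 1"
    and tau_cocycle: "g \<in> carrier G \<Longrightarrow> g' \<in> carrier G \<Longrightarrow> g'' \<in> carrier G \<Longrightarrow> f \<in> carrier F \<Longrightarrow>
      \<tau> g g' (g'' \<triangleright> f) * \<tau> (g \<otimes>\<^bsub>G\<^esub> g') g'' f = \<tau> g (g' \<otimes>\<^bsub>G\<^esub> g'') f * \<tau> g' g'' f"
    and sigma_tau: "g \<in> carrier G \<Longrightarrow> g' \<in> carrier G \<Longrightarrow> f \<in> carrier F \<Longrightarrow> f' \<in> carrier F \<Longrightarrow>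
      \<sigma> (g \<otimes>\<^bsub>G\<^esub> g') f f' * \<tau> g g' (f \<otimes>\<^bsub>F\<^esub> f') =
      \<sigma> g (g' \<triangleright> f) ((g' \<triangleleft> f) \<triangleright> f') * \<sigma> g' f f' * \<tau> g g' f *
      \<tau> (g \<triangleleft> (g' \<triangleright> f)) (g' \<triangleleft> f) f'"

text \<open>The basis vector \<open>p\<^sub>g # f\<close> is \<open>basis_vec (g, f)\<close>. The group \<open>G\<close> is to be finite.\<close>

definition bismash ::
  "('g, 'm) monoid_scheme \<Rightarrow> ('f, 'n) monoid_scheme \<Rightarrow> ('g \<Rightarrow> 'f \<Rightarrow> 'g) \<Rightarrow> ('g \<Rightarrow> 'f \<Rightarrow> 'f) \<Rightarrow>
     ('g \<Rightarrow> 'f \<Rightarrow> 'f \<Rightarrow> 'k::field) \<Rightarrow> ('g \<Rightarrow> 'g \<Rightarrow> 'f \<Rightarrow> 'k) \<Rightarrow> ('g \<times> 'f, 'k) hopf" where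
  "bismash G F ract lact \<sigma> \<tau> = \<lparr>
     cbasis = carrier G \<times> carrier F,
     comul = linear_ext scale2 (\<lambda>(g, f). \<Sum>x\<in>carrier G.
       scale2 (\<tau> (g \<otimes>\<^bsub>G\<^esub> inv\<^bsub>G\<^esub> x) x f)
         (tensor scale1 (basis_vec (g \<otimes>\<^bsub>G\<^esub> inv\<^bsub>G\<^esub> x, lact x f)) (basis_vec (x, f)))),
     counit = linear_ext (*) (\<lambda>(g, f). if g = \<one>\<^bsub>G\<^esub> then 1 else 0),
     hmul = (\<lambda>a b. linear_ext scale1 (\<lambda>(g, f). linear_ext scale1 (\<lambda>(g', f').
       if ract g f = g' then scale1 (\<sigma> g f f') (basis_vec (g, f \<otimes>\<^bsub>F\<^esub> f')) else 0) b) a),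
     hunit = (\<Sum>g\<in>carrier G. basis_vec (g, \<one>\<^bsub>F\<^esub>)),
     antipode = linear_ext scale1 (\<lambda>(g, f).
       scale1 (inverse (\<sigma> (inv\<^bsub>G\<^esub> g) (lact g f) (inv\<^bsub>F\<^esub> (lact g f))) *
               inverse (\<tau> (inv\<^bsub>G\<^esub> g) g f))
         (basis_vec (inv\<^bsub>G\<^esub> (ract g f), inv\<^bsub>F\<^esub> (lact g f)))) \<rparr>"

text \<open>The coalgebra of functions on \<open>G\<close>, with basis vector \<open>p\<^sub>g\<close> rendered as \<open>basis_vec g\<close>.\<close>

definition function_coalg :: "('g, 'm) monoid_scheme \<Rightarrow> ('g, 'k::field) coalg" where
  "function_coalg G = \<lparr>
     cbasis = carrier G,
     comul = linear_ext scale2 (\<lambda>g. \<Sum>x\<in>carrier G.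
       tensor scale1 (basis_vec (g \<otimes>\<^bsub>G\<^esub> inv\<^bsub>G\<^esub> x)) (basis_vec x)),
     counit = linear_ext (*) (\<lambda>g. if g = \<one>\<^bsub>G\<^esub> then 1 else 0) \<rparr>"

definition twisted_stabilizer_coalg ::
  "('g, 'm) monoid_scheme \<Rightarrow> ('g \<Rightarrow> 'f \<Rightarrow> 'f) \<Rightarrow> ('g \<Rightarrow> 'g \<Rightarrow> 'f \<Rightarrow> 'k::field) \<Rightarrow> 'f \<Rightarrow>
     ('g, 'k) coalg" where
  "twisted_stabilizer_coalg G lact \<tau> f = \<lparr>
     cbasis = stabilizer G lact f,
     comul = linear_ext scale2 (\<lambda>g. \<Sum>x\<in>stabilizer G lact f.
       scale2 (\<tau> (g \<otimes>\<^bsub>G\<^esub> inv\<^bsub>G\<^esub> x) x f)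
         (tensor scale1 (basis_vec (g \<otimes>\<^bsub>G\<^esub> inv\<^bsub>G\<^esub> x)) (basis_vec x))),
     counit = linear_ext (*) (\<lambda>g. if g = \<one>\<^bsub>G\<^esub> then 1 else 0) \<rparr>"

definition right_coset_representatives ::
  "('g, 'm) monoid_scheme \<Rightarrow> 'g set \<Rightarrow> 'g set \<Rightarrow> bool" where
  "right_coset_representatives G H T \<longleftrightarrow>
     T \<subseteq> carrier G \<and> (\<forall>x\<in>carrier G. \<exists>!(h, z). h \<in> H \<and> z \<in> T \<and> x = h \<otimes>\<^bsub>G\<^esub> z)"

end

theory Submission
  imports Defs
begin

text \<open>
  Let \<open>H\<close> be the bismash product. The proof is a comparison of two products of characters.

  In a coquasitriangular Hopf algebra two cocommutative elements \<open>a\<close> and \<open>b\<close> commute. Indeed, the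
  bilinear forms on \<open>H\<close> are an algebra under convolution, dual to the coalgebra \<open>H \<otimes> H\<close>. Fix a
  basis vector \<open>w\<close> and let \<open>m(x, y)\<close> and \<open>m'(x, y)\<close> be the coefficients of \<open>w\<close> in \<open>x y\<close> and in
  \<open>y x\<close>. The braiding axiom says that \<open>R m = m' R\<close>, so \<open>m\<close> and \<open>m'\<close> are conjugate under the
  invertible form \<open>R\<close>. Evaluation at the cocommutative element \<open>a \<otimes> b\<close> is a trace on the
  convolution algebra, and a trace does not distinguish conjugate elements
  (\<open>trace_of_conjugates\<close>, \<open>cocommutative_elements_commute\<close>).

  Characters of comodules are cocommutative, because the matrix \<open>C\<close> of a coaction satisfies
  \<open>\<Delta> c\<^sub>k\<^sub>i = \<Sum>\<^sub>l c\<^sub>k\<^sub>l \<otimes> c\<^sub>l\<^sub>i\<close> (\<open>comodule_character_cocommutative\<close>). So the character \<open>B\<close> of \<open>W\<close> is a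
  class function on \<open>G\<close>, and the character \<open>A\<close> of \<open>V\<close> satisfies
  \<open>\<tau>(y, x; f) A(y x) = \<tau>(x, y; f) A(x y)\<close> on the stabilizer of \<open>f\<close>. The formula for
  induced characters turns \<open>A\<close> into a function \<open>X\<close> of pairs \<open>(h, f')\<close> with \<open>f'\<close> in the orbit of \<open>f\<close>,
  for which \<open>\<chi> = \<Sum> X(h, f') p\<^sub>h # f'\<close> is cocommutative in \<open>H\<close> (\<open>twisted_class_function_induce\<close>,
  \<open>class_element_cocommutative\<close>). So is \<open>\<psi> = \<Sum> B(h) p\<^sub>h # 1\<close>, and hence \<open>\<chi> \<psi> = \<psi> \<chi>\<close>.

  The coefficients of \<open>p\<^sub>h # f'\<close> in these two products are \<open>X(h, f') B(h \<triangleleft> f')\<close> and \<open>B(h) X(h, f')\<close>.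
  For \<open>f' = z\<inverse> \<triangleright> f\<close> and \<open>h = z\<inverse> g z\<close> the number \<open>X(h, f')\<close> is a nonzero multiple of \<open>A(g)\<close>
  (\<open>induce_conjugate\<close>), which gives the identity.
\<close>

section \<open>Traces on the convolution algebra of a coalgebra\<close>

text \<open>
  The convolution product of two functionals on a coalgebra with basis \<open>I\<close>, where \<open>D u x y\<close> is the
  coefficient of \<open>x \<otimes> y\<close> in the coproduct of \<open>u\<close>.
\<close>

definition conv :: "'i set \<Rightarrow> ('i \<Rightarrow> 'i \<Rightarrow> 'i \<Rightarrow> 'k::field) \<Rightarrow> ('i \<Rightarrow> 'k) \<Rightarrow> ('i \<Rightarrow> 'k) \<Rightarrow> 'i \<Rightarrow> 'k" where
  "conv I D p q u = (\<Sum>x\<in>I. \<Sum>y\<in>I. D u x y * p x * q y)"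

lemma conv_cong:
  assumes "\<And>x. x \<in> I \<Longrightarrow> p x = p' x" "\<And>x. x \<in> I \<Longrightarrow> q x = q' x"
  shows "conv I D p q = conv I D p' q'"
  using assms by (auto simp: conv_def fun_eq_iff intro!: sum.cong)

lemma conv_assoc:
  assumes "\<And>x y z. x \<in> I \<Longrightarrow> y \<in> I \<Longrightarrow> z \<in> I \<Longrightarrow>
    (\<Sum>t\<in>I. D u t z * D t x y) = (\<Sum>t\<in>I. D u x t * D t y z)"
  shows "conv I D (conv I D p q) r u = conv I D p (conv I D q r) u"
proof -
  have "conv I D (conv I D p q) r u =
      (\<Sum>t\<in>I. \<Sum>z\<in>I. \<Sum>x\<in>I. \<Sum>y\<in>I. D u t z * D t x y * (p x * q y * r z))"
    by (simp add: conv_def sum_distrib_left sum_distrib_right mult_ac)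
  also have "\<dots> = (\<Sum>t\<in>I. \<Sum>x\<in>I. \<Sum>z\<in>I. \<Sum>y\<in>I. D u t z * D t x y * (p x * q y * r z))"
    by (rule sum.cong[OF refl], rule sum.swap)
  also have "\<dots> = (\<Sum>x\<in>I. \<Sum>t\<in>I. \<Sum>z\<in>I. \<Sum>y\<in>I. D u t z * D t x y * (p x * q y * r z))"
    by (rule sum.swap)
  also have "\<dots> = (\<Sum>x\<in>I. \<Sum>t\<in>I. \<Sum>y\<in>I. \<Sum>z\<in>I. D u t z * D t x y * (p x * q y * r z))"
    by (rule sum.cong[OF refl], rule sum.cong[OF refl], rule sum.swap)
  also have "\<dots> = (\<Sum>x\<in>I. \<Sum>y\<in>I. \<Sum>t\<in>I. \<Sum>z\<in>I. D u t z * D t x y * (p x * q y * r z))"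
    by (rule sum.cong[OF refl], rule sum.swap)
  also have "\<dots> = (\<Sum>x\<in>I. \<Sum>y\<in>I. \<Sum>z\<in>I. \<Sum>t\<in>I. D u t z * D t x y * (p x * q y * r z))"
    by (rule sum.cong[OF refl], rule sum.cong[OF refl], rule sum.swap)
  also have "\<dots> = (\<Sum>x\<in>I. \<Sum>y\<in>I. \<Sum>z\<in>I. \<Sum>t\<in>I. D u x t * D t y z * (p x * q y * r z))"
    by (rule sum.cong[OF refl], rule sum.cong[OF refl], rule sum.cong[OF refl])
       (simp only: assms sum_distrib_right[symmetric])
  also have "\<dots> = (\<Sum>x\<in>I. \<Sum>y\<in>I. \<Sum>t\<in>I. \<Sum>z\<in>I. D u x t * D t y z * (p x * q y * r z))"
    by (rule sum.cong[OF refl], rule sum.cong[OF refl], rule sum.swap)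
  also have "\<dots> = (\<Sum>x\<in>I. \<Sum>t\<in>I. \<Sum>y\<in>I. \<Sum>z\<in>I. D u x t * D t y z * (p x * q y * r z))"
    by (rule sum.cong[OF refl], rule sum.swap)
  also have "\<dots> = conv I D p (conv I D q r) u"
    by (simp add: conv_def sum_distrib_left sum_distrib_right mult_ac)
  finally show ?thesis .
qed

text \<open>
  Here \<open>\<gamma>\<close> holds the coordinates of an element of the coalgebra, and the two sides are the values of
  functionals at this element. Cocommutativity of the element is the trace property for two coordinate
  functionals, and the general case follows by bilinearity.
\<close>

lemma conv_trace:
  assumes "\<And>x y. x \<in> I \<Longrightarrow> y \<in> I \<Longrightarrow> (\<Sum>u\<in>I. \<gamma> u * D u x y) = (\<Sum>u\<in>I. \<gamma> u * D u y x)"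
  shows "(\<Sum>u\<in>I. \<gamma> u * conv I D p q u) = (\<Sum>u\<in>I. \<gamma> u * conv I D q p u)"
proof -
  have expand: "(\<Sum>u\<in>I. \<gamma> u * conv I D p q u) = (\<Sum>x\<in>I. \<Sum>y\<in>I. (\<Sum>u\<in>I. \<gamma> u * D u x y) * (p x * q y))"
    (is "?L p q = ?R p q") for p q
  proof -
    have "?L p q = (\<Sum>u\<in>I. \<Sum>x\<in>I. \<Sum>y\<in>I. \<gamma> u * D u x y * (p x * q y))"
      by (simp add: conv_def sum_distrib_left mult_ac)
    also have "\<dots> = (\<Sum>x\<in>I. \<Sum>u\<in>I. \<Sum>y\<in>I. \<gamma> u * D u x y * (p x * q y))"
      by (rule sum.swap)
    also have "\<dots> = (\<Sum>x\<in>I. \<Sum>y\<in>I. \<Sum>u\<in>I. \<gamma> u * D u x y * (p x * q y))"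
      by (rule sum.cong[OF refl], rule sum.swap)
    finally show ?thesis by (simp add: sum_distrib_right)
  qed
  have "?R p q = (\<Sum>x\<in>I. \<Sum>y\<in>I. (\<Sum>u\<in>I. \<gamma> u * D u y x) * (q y * p x))"
    by (intro sum.cong refl) (simp add: assms mult.commute)
  also have "\<dots> = ?R q p"
    by (rule sum.swap)
  finally show ?thesis by (simp add: expand)
qed

text \<open>
  If \<open>e\<close> is a unit and \<open>q\<close> is inverse to \<open>r\<close>, then the last assumption says that \<open>m' = r m q\<close>,
  and the trace moves \<open>r\<close> to the right, where it cancels against \<open>q\<close>.
\<close>

lemma trace_of_conjugates:
  assumes coassoc: "\<And>u x y z. u \<in> I \<Longrightarrow> x \<in> I \<Longrightarrow> y \<in> I \<Longrightarrow> z \<in> I \<Longrightarrow>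
      (\<Sum>t\<in>I. D u t z * D t x y) = (\<Sum>t\<in>I. D u x t * D t y z)"
    and trace: "\<And>x y. x \<in> I \<Longrightarrow> y \<in> I \<Longrightarrow> (\<Sum>u\<in>I. \<gamma> u * D u x y) = (\<Sum>u\<in>I. \<gamma> u * D u y x)"
    and unit: "\<And>p u. u \<in> I \<Longrightarrow> conv I D p e u = p u"
    and rq: "\<And>u. u \<in> I \<Longrightarrow> conv I D r q u = e u"
    and qr: "\<And>u. u \<in> I \<Longrightarrow> conv I D q r u = e u"
    and conj: "\<And>u. u \<in> I \<Longrightarrow> conv I D r m u = conv I D m' r u"
  shows "(\<Sum>u\<in>I. \<gamma> u * m u) = (\<Sum>u\<in>I. \<gamma> u * m' u)"
proof -
  note assoc = conv_assoc[of I D, OF coassoc]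
  have "m' u = conv I D r (conv I D m q) u" if "u \<in> I" for u
  proof -
    have "m' u = conv I D m' (conv I D r q) u"
      using that by (simp add: unit rq cong: conv_cong)
    also have "\<dots> = conv I D (conv I D r m) q u"
      using that by (simp add: assoc[symmetric] conj cong: conv_cong)
    also have "\<dots> = conv I D r (conv I D m q) u"
      using that by (rule assoc)
    finally show ?thesis .
  qed
  then have "(\<Sum>u\<in>I. \<gamma> u * m' u) = (\<Sum>u\<in>I. \<gamma> u * conv I D r (conv I D m q) u)"
    by simp
  also have "\<dots> = (\<Sum>u\<in>I. \<gamma> u * conv I D (conv I D m q) r u)"
    by (rule conv_trace) (rule trace)
  also have "\<dots> = (\<Sum>u\<in>I. \<gamma> u * m u)"
    by (intro sum.cong refl) (simp add: assoc qr unit cong: conv_cong)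
  finally show ?thesis by simp
qed

section \<open>Coefficients of linear maps and of Sweedler sums\<close>

lemma lookup_pscale:
  assumes "s c 0 = 0"
  shows "Poly_Mapping.lookup (pscale s c t) y = s c (Poly_Mapping.lookup t y)"
  using assms by (simp add: pscale_def Poly_Mapping.map.rep_eq when_def)

lemma lookup_tensor:
  assumes "s 0 v = 0"
  shows "Poly_Mapping.lookup (tensor s v t) y = s (Poly_Mapping.lookup t y) v"
  using assms by (auto simp add: tensor_def Poly_Mapping.map.rep_eq when_def)

lemma lookup_scale1 [simp]: "Poly_Mapping.lookup (scale1 c t) y = c * Poly_Mapping.lookup t y"
  by (simp add: lookup_pscale)

lemma scale1_zero [simp]: "scale1 c 0 = 0"  "scale1 0 t = 0"
  by (auto intro!: poly_mapping_eqI)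

lemma lookup_scale2 [simp]: "Poly_Mapping.lookup (scale2 c t) y = scale1 c (Poly_Mapping.lookup t y)"
  by (simp add: lookup_pscale)

lemma scale2_zero [simp]: "scale2 c 0 = 0" "scale2 0 t = 0"
  by (auto intro!: poly_mapping_eqI)

lemma lookup_tensor1 [simp]:
  "Poly_Mapping.lookup (tensor scale1 v t) y = scale1 (Poly_Mapping.lookup t y) v"
  by (simp add: lookup_tensor)

lemma lookup_tensor2 [simp]:
  "Poly_Mapping.lookup (tensor scale2 v t) y = scale2 (Poly_Mapping.lookup t y) v"
  by (simp add: lookup_tensor)

lemma basis_vec_in_free_space [simp]: "x \<in> B \<Longrightarrow> (basis_vec x :: 'b \<Rightarrow>\<^sub>0 'k::zero_neq_one) \<in> free_space B"
  by (simp add: free_space_def)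

lemma free_space_lookup: "a \<in> free_space B \<Longrightarrow> x \<notin> B \<Longrightarrow> Poly_Mapping.lookup a x = 0"
  by (auto simp: free_space_def in_keys_iff)

lemma linear_on_expand:
  fixes f :: "('b \<Rightarrow>\<^sub>0 'k::field) \<Rightarrow> 'k"
  assumes f: "linear_on (free_space B) scale1 (*) f"
    and K: "finite K" "K \<subseteq> B" "a \<in> free_space K"
  shows "f a = (\<Sum>x\<in>K. Poly_Mapping.lookup a x * f (basis_vec x))"
proof -
  have "f (scale1 0 0) = 0 * f 0"
    using f unfolding linear_on_def by (auto simp: free_space_def simp del: scale1_zero)
  then have f0: "f 0 = 0" by simp
  have *: "(\<Sum>x\<in>L. scale1 (c x) (basis_vec x)) \<in> free_space B \<and>
      f (\<Sum>x\<in>L. scale1 (c x) (basis_vec x)) = (\<Sum>x\<in>L. c x * f (basis_vec x))"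
    if "finite L" "L \<subseteq> B" for L and c :: "'b \<Rightarrow> 'k"
    using that
  proof (induction L)
    case empty
    then show ?case using f0 by (simp add: free_space_def)
  next
    case (insert y L)
    let ?s = "scale1 (c y) (basis_vec y)" and ?S = "\<Sum>x\<in>L. scale1 (c x) (basis_vec x)"
    have mem: "?s \<in> free_space B"
      using insert.prems unfolding free_space_def
      by (auto simp: in_keys_iff lookup_single when_def split: if_splits)
    have S: "?S \<in> free_space B" "f ?S = (\<Sum>x\<in>L. c x * f (basis_vec x))"
      using insert by blast+
    have "?s + ?S \<in> free_space B"
      using mem S(1) Poly_Mapping.keys_add[of ?s ?S] unfolding free_space_def by blast
    moreover have "f (?s + ?S) = f ?s + f ?S"
      using f mem S(1) unfolding linear_on_def by blast
    moreover have "f ?s = c y * f (basis_vec y)"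
      using f insert.prems basis_vec_in_free_space[of y B] unfolding linear_on_def by blast
    ultimately show ?case
      using insert.hyps S(2) by simp
  qed
  have "a = (\<Sum>x\<in>K. scale1 (Poly_Mapping.lookup a x) (basis_vec x))"
  proof (rule poly_mapping_eqI)
    fix z
    have "(\<Sum>x\<in>K. Poly_Mapping.lookup a x * Poly_Mapping.lookup (basis_vec x) z) =
        (\<Sum>x\<in>K. if x = z then Poly_Mapping.lookup a x else 0)"
      by (intro sum.cong refl) (simp add: lookup_single when_def)
    then show "Poly_Mapping.lookup a z =
        Poly_Mapping.lookup (\<Sum>x\<in>K. scale1 (Poly_Mapping.lookup a x) (basis_vec x)) z"
      using K free_space_lookup[of a K z] by (simp add: lookup_sum sum.delta')
  qed
  then have "f a = f (\<Sum>x\<in>K. scale1 (Poly_Mapping.lookup a x) (basis_vec x))"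
    by (rule arg_cong)
  also have "\<dots> = (\<Sum>x\<in>K. Poly_Mapping.lookup a x * f (basis_vec x))"
    using *[OF K(1,2)] by blast
  finally show ?thesis .
qed

text \<open>
  A map given by a sum in Sweedler notation is determined by its values on pairs of basis vectors,
  so that the axioms for coalgebras turn into identities between structure constants.
\<close>

lemma sweedler_expand:
  fixes t :: "'b \<Rightarrow>\<^sub>0 'b \<Rightarrow>\<^sub>0 'k::field"
  assumes t: "t \<in> tensor_space (free_space K) K" and K: "finite K"
    and lin: "\<And>y. y \<in> K \<Longrightarrow> linear_on (free_space K) scale1 (*) (\<lambda>a. \<phi> a (basis_vec y))"
  shows "sweedler t \<phi> =
    (\<Sum>y\<in>K. \<Sum>x\<in>K. Poly_Mapping.lookup (Poly_Mapping.lookup t y) x * \<phi> (basis_vec x) (basis_vec y))"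
proof -
  have eq: "\<phi> (Poly_Mapping.lookup t y) (basis_vec y) =
     (\<Sum>x\<in>K. Poly_Mapping.lookup (Poly_Mapping.lookup t y) x * \<phi> (basis_vec x) (basis_vec y))" if "y \<in> K" for y
    using t that by (intro linear_on_expand[OF lin]) (auto simp: K tensor_space_def)
  have "sweedler t \<phi> = (\<Sum>y\<in>K. \<phi> (Poly_Mapping.lookup t y) (basis_vec y))"
    unfolding sweedler_def
  proof (rule sum.mono_neutral_left)
    show "Poly_Mapping.keys t \<subseteq> K" using t by (simp add: tensor_space_def)
    show "\<forall>y\<in>K - Poly_Mapping.keys t. \<phi> (Poly_Mapping.lookup t y) (basis_vec y) = 0"
    proof
      fix y assume "y \<in> K - Poly_Mapping.keys t"
      then show "\<phi> (Poly_Mapping.lookup t y) (basis_vec y) = 0"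
        using eq[of y] by (simp add: in_keys_iff)
    qed
  qed (fact K)
  also have "\<dots> = (\<Sum>y\<in>K. \<Sum>x\<in>K.
      Poly_Mapping.lookup (Poly_Mapping.lookup t y) x * \<phi> (basis_vec x) (basis_vec y))"
    by (intro sum.cong refl eq)
  finally show ?thesis .
qed

lemma lookup_linear_ext1:
  fixes \<phi> :: "'b \<Rightarrow> 'c \<Rightarrow>\<^sub>0 'k::field"
  assumes "finite K" "a \<in> free_space K"
  shows "Poly_Mapping.lookup (linear_ext scale1 \<phi> a) y =
    (\<Sum>u\<in>K. Poly_Mapping.lookup a u * Poly_Mapping.lookup (\<phi> u) y)"
  unfolding linear_ext_def lookup_sum lookup_scale1
  using assms by (intro sum.mono_neutral_left) (auto simp: free_space_def in_keys_iff)

lemma lookup_linear_ext2: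
  fixes \<phi> :: "'b \<Rightarrow> 'c \<Rightarrow>\<^sub>0 'd \<Rightarrow>\<^sub>0 'k::field"
  assumes "finite K" "a \<in> free_space K"
  shows "Poly_Mapping.lookup (Poly_Mapping.lookup (linear_ext scale2 \<phi> a) y) x =
    (\<Sum>u\<in>K. Poly_Mapping.lookup a u * Poly_Mapping.lookup (Poly_Mapping.lookup (\<phi> u) y) x)"
  unfolding linear_ext_def lookup_sum lookup_scale2 lookup_scale1
  using assms by (intro sum.mono_neutral_left) (auto simp: free_space_def in_keys_iff)

section \<open>Structure constants of coalgebras\<close>

text \<open>
  The coefficient of \<open>x \<otimes> y\<close>: the right tensor factor is the one that is looked up first.
\<close>

abbreviation tcoeff :: "('b \<Rightarrow>\<^sub>0 'b \<Rightarrow>\<^sub>0 'k::zero) \<Rightarrow> 'b \<Rightarrow> 'b \<Rightarrow> 'k" where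
  "tcoeff t x y \<equiv> Poly_Mapping.lookup (Poly_Mapping.lookup t y) x"

definition cocommutative :: "('b, 'k::field, 'm) coalg_scheme \<Rightarrow> ('b \<Rightarrow>\<^sub>0 'k) \<Rightarrow> bool" where
  "cocommutative C a \<longleftrightarrow> (\<forall>x y. tcoeff (comul C a) x y = tcoeff (comul C a) y x)"

lemma free_space_mono: "a \<in> free_space K \<Longrightarrow> K \<subseteq> B \<Longrightarrow> a \<in> free_space B"
  by (auto simp: free_space_def)

lemma linear_on_free_space_subset:
  "linear_on (free_space B) s s' f \<Longrightarrow> K \<subseteq> B \<Longrightarrow> linear_on (free_space K) s s' f"
  unfolding linear_on_def by (meson free_space_mono)

lemma comul_coeff_expand:
  assumes "coalgebra C" "finite K" "K \<subseteq> cbasis C" "a \<in> free_space K"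
  shows "tcoeff (comul C a) x y =
    (\<Sum>u\<in>K. Poly_Mapping.lookup a u * tcoeff (comul C (basis_vec u)) x y)"
proof (rule linear_on_expand)
  show "linear_on (free_space (cbasis C)) scale1 (*) (\<lambda>a. tcoeff (comul C a) x y)"
    using assms(1) by (auto simp: coalgebra_def linear_on_def lookup_add)
qed (use assms in auto)

lemma lookup_sweedler:
  "Poly_Mapping.lookup (sweedler t \<phi>) z = sweedler t (\<lambda>a b. Poly_Mapping.lookup (\<phi> a b) z)"
  by (simp add: sweedler_def lookup_sum)

lemma sweedler_cong:
  assumes "t \<in> tensor_space V K" "\<And>v y. v \<in> V \<Longrightarrow> y \<in> K \<Longrightarrow> \<phi> v (basis_vec y) = \<psi> v (basis_vec y)"
  shows "sweedler t \<phi> = sweedler t \<psi>"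
  using assms by (auto simp: sweedler_def tensor_space_def intro!: sum.cong)

lemma sum_basis_left [simp]:
  "finite K \<Longrightarrow> z \<in> K \<Longrightarrow> (\<Sum>y\<in>K. f y * Poly_Mapping.lookup (basis_vec y) z) = (f z :: 'k::field)"
  by (simp add: lookup_single when_def if_distrib cong: if_cong)

text \<open>
  Both sides are the coefficient of \<open>x \<otimes> y \<otimes> z\<close> in the threefold coproduct of \<open>u\<close>. A finite set
  \<open>K\<close> of basis vectors that spans a subcoalgebra keeps all sums finite.
\<close>

lemma coassoc_coeff:
  fixes C :: "('b, 'k::field, 'm) coalg_scheme"
  defines "D \<equiv> \<lambda>u. tcoeff (comul C (basis_vec u))"
  assumes C: "coalgebra C" and K: "finite K" "K \<subseteq> cbasis C"
    and sub: "\<And>u. u \<in> K \<Longrightarrow> comul C (basis_vec u) \<in> tensor_space (free_space K) K"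
    and "u \<in> K" "x \<in> K" "y \<in> K" "z \<in> K"
  shows "(\<Sum>t\<in>K. D u t z * D t x y) = (\<Sum>t\<in>K. D u x t * D t y z)"
proof -
  let ?e = "basis_vec :: 'b \<Rightarrow> 'b \<Rightarrow>\<^sub>0 'k"
  let ?L = "\<lambda>a b. Poly_Mapping.lookup b z * tcoeff (comul C a) x y"
  let ?R = "\<lambda>a b. sweedler (comul C b) (\<lambda>b1 b2. Poly_Mapping.lookup b2 z *
                    (Poly_Mapping.lookup b1 y * Poly_Mapping.lookup a x))"
  have mem: "?e u \<in> cspace C"
    using \<open>u \<in> K\<close> K(2) by auto
  have "sweedler (comul C (?e u)) (\<lambda>a1 a2. tensor scale2 (comul C a1) a2) =
        sweedler (comul C (?e u)) (\<lambda>a1 a2. sweedler (comul C a2)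
          (\<lambda>a2' a2''. tensor scale2 (tensor scale1 a1 a2') a2''))" (is "?A = ?B")
    using C mem unfolding coalgebra_def by blast
  then have "tcoeff (Poly_Mapping.lookup ?A z) x y = tcoeff (Poly_Mapping.lookup ?B z) x y"
    by (rule arg_cong)
  then have eq: "sweedler (comul C (?e u)) ?L = sweedler (comul C (?e u)) ?R"
    by (simp only: lookup_sweedler lookup_tensor2 lookup_tensor1 lookup_scale2 lookup_scale1)
  have "sweedler (comul C (?e u)) ?L =
     (\<Sum>t'\<in>K. \<Sum>t\<in>K. D u t t' * (Poly_Mapping.lookup (?e t') z * D t x y))"
    unfolding D_def
  proof (rule sweedler_expand[OF sub[OF \<open>u \<in> K\<close>] K(1)])
    fix t assume "t \<in> K"
    have "linear_on (free_space (cbasis C)) scale1 (*) (\<lambda>a. ?L a (?e t))"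
      using C by (auto simp: coalgebra_def linear_on_def lookup_add algebra_simps)
    then show "linear_on (free_space K) scale1 (*) (\<lambda>a. ?L a (?e t))"
      using K(2) by (rule linear_on_free_space_subset)
  qed
  also have "\<dots> = (\<Sum>t\<in>K. D u t z * D t x y)"
  proof -
    have "\<dots> = (\<Sum>t\<in>K. \<Sum>t'\<in>K. (D u t t' * D t x y) * Poly_Mapping.lookup (?e t') z)"
      by (subst sum.swap) (simp add: mult_ac)
    then show ?thesis using K \<open>z \<in> K\<close> by simp
  qed
  finally have left: "sweedler (comul C (?e u)) ?L = (\<Sum>t\<in>K. D u t z * D t x y)" .
  have inner: "?R a (?e t) = D t y z * Poly_Mapping.lookup a x" if "t \<in> K" for a t
  proof -
    have "?R a (?e t) = (\<Sum>t'\<in>K. \<Sum>s\<in>K. D t s t' *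
        (Poly_Mapping.lookup (?e t') z * (Poly_Mapping.lookup (?e s) y * Poly_Mapping.lookup a x)))"
      unfolding D_def
      by (rule sweedler_expand[OF sub[OF that] K(1)]) (auto simp: linear_on_def lookup_add algebra_simps)
    also have "\<dots> = (\<Sum>t'\<in>K. (\<Sum>s\<in>K. (D t s t' * Poly_Mapping.lookup a x) * Poly_Mapping.lookup (?e s) y)
        * Poly_Mapping.lookup (?e t') z)"
      by (simp add: sum_distrib_left sum_distrib_right mult_ac)
    also have "\<dots> = D t y z * Poly_Mapping.lookup a x"
      using K \<open>y \<in> K\<close> \<open>z \<in> K\<close> by (simp only: sum_basis_left)
    finally show ?thesis .
  qed
  have "sweedler (comul C (?e u)) ?R =
     (\<Sum>t\<in>K. \<Sum>s\<in>K. D u s t * ?R (?e s) (?e t))"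
    unfolding D_def
    by (rule sweedler_expand[OF sub[OF \<open>u \<in> K\<close>] K(1)])
       (simp only: inner, auto simp: linear_on_def lookup_add algebra_simps)
  also have "\<dots> = (\<Sum>t\<in>K. \<Sum>s\<in>K. (D u s t * D t y z) * Poly_Mapping.lookup (?e s) x)"
    by (intro sum.cong refl) (simp only: inner mult.assoc)
  also have "\<dots> = (\<Sum>t\<in>K. D u x t * D t y z)"
    using K \<open>x \<in> K\<close> by (simp only: sum_basis_left)
  finally show ?thesis using left eq by simp
qed

lemma counit_coeff:
  fixes C :: "('b, 'k::field, 'm) coalg_scheme"
  assumes C: "coalgebra C" and K: "finite K" "K \<subseteq> cbasis C"
    and sub: "\<And>u. u \<in> K \<Longrightarrow> comul C (basis_vec u) \<in> tensor_space (free_space K) K"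
    and "u \<in> K" "x \<in> K"
  shows "(\<Sum>y\<in>K. tcoeff (comul C (basis_vec u)) x y * counit C (basis_vec y)) = (if x = u then 1 else 0)"
proof -
  let ?e = "basis_vec :: 'b \<Rightarrow> 'b \<Rightarrow>\<^sub>0 'k"
  have "?e u \<in> cspace C"
    using \<open>u \<in> K\<close> K(2) by auto
  then have "?e u = sweedler (comul C (?e u)) (\<lambda>a1 a2. scale1 (counit C a2) a1)" (is "_ = ?S")
    using C unfolding coalgebra_def by metis
  then have "Poly_Mapping.lookup (?e u) x = Poly_Mapping.lookup ?S x"
    by (rule arg_cong)
  also have "\<dots> = sweedler (comul C (?e u)) (\<lambda>a1 a2. counit C a2 * Poly_Mapping.lookup a1 x)"
    by (simp only: lookup_sweedler lookup_scale1)
  also have "\<dots> = (\<Sum>y\<in>K. \<Sum>s\<in>K. tcoeff (comul C (?e u)) s y *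
      (counit C (?e y) * Poly_Mapping.lookup (?e s) x))"
    by (rule sweedler_expand[OF sub[OF \<open>u \<in> K\<close>] K(1)]) (auto simp: linear_on_def lookup_add algebra_simps)
  also have "\<dots> = (\<Sum>y\<in>K. tcoeff (comul C (?e u)) x y * counit C (?e y))"
    using K \<open>x \<in> K\<close> by (simp only: sum_basis_left mult.assoc[symmetric])
  finally show ?thesis by (auto simp: lookup_single when_def)
qed

text \<open>
  Pairs \<open>p, q \<in> K \<times> K\<close> index the basis of the tensor square of the span of \<open>K\<close>: \<open>p\<close> collects the
  left tensor factors of the two coproducts, and \<open>q\<close> the right ones.
\<close>

lemma double_sweedler_expand:
  fixes s t :: "'b \<Rightarrow>\<^sub>0 'b \<Rightarrow>\<^sub>0 'k::field"
    and \<psi> :: "('b \<Rightarrow>\<^sub>0 'k) \<Rightarrow> ('b \<Rightarrow>\<^sub>0 'k) \<Rightarrow> ('b \<Rightarrow>\<^sub>0 'k) \<Rightarrow> ('b \<Rightarrow>\<^sub>0 'k) \<Rightarrow> 'k"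
  assumes st: "s \<in> tensor_space (free_space K) K" "t \<in> tensor_space (free_space K) K"
    and K: "finite K"
    and lin1: "\<And>x' y y'. x' \<in> K \<Longrightarrow> y \<in> K \<Longrightarrow> y' \<in> K \<Longrightarrow>
       linear_on (free_space K) scale1 (*) (\<lambda>a. \<psi> a (basis_vec x') (basis_vec y) (basis_vec y'))"
    and lin2: "\<And>a x' y'. a \<in> free_space K \<Longrightarrow> x' \<in> K \<Longrightarrow> y' \<in> K \<Longrightarrow>
       linear_on (free_space K) scale1 (*) (\<lambda>b. \<psi> a (basis_vec x') b (basis_vec y'))"
  shows "sweedler s (\<lambda>a1 a2. sweedler t (\<lambda>b1 b2. \<psi> a1 a2 b1 b2)) =
    (\<Sum>p\<in>K \<times> K. \<Sum>q\<in>K \<times> K. tcoeff s (fst p) (fst q) * tcoeff t (snd p) (snd q) *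
      \<psi> (basis_vec (fst p)) (basis_vec (fst q)) (basis_vec (snd p)) (basis_vec (snd q)))"
proof -
  let ?e = "basis_vec :: 'b \<Rightarrow> 'b \<Rightarrow>\<^sub>0 'k"
  have inner: "sweedler t (\<psi> a (?e x')) =
      (\<Sum>y'\<in>K. \<Sum>y\<in>K. tcoeff t y y' * \<psi> a (?e x') (?e y) (?e y'))"
    if "a \<in> free_space K" "x' \<in> K" for a x'
    using that by (intro sweedler_expand[OF st(2) K] lin2)
  have "sweedler s (\<lambda>a1 a2. sweedler t (\<lambda>b1 b2. \<psi> a1 a2 b1 b2)) =
      sweedler s (\<lambda>a1 a2. \<Sum>y'\<in>K. \<Sum>y\<in>K. tcoeff t y y' * \<psi> a1 a2 (?e y) (?e y'))"
    by (rule sweedler_cong[OF st(1)]) (simp add: inner)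
  also have "\<dots> = (\<Sum>x'\<in>K. \<Sum>x\<in>K. tcoeff s x x' *
      (\<Sum>y'\<in>K. \<Sum>y\<in>K. tcoeff t y y' * \<psi> (?e x) (?e x') (?e y) (?e y')))"
  proof (rule sweedler_expand[OF st(1) K])
    fix x' assume x': "x' \<in> K"
    show "linear_on (free_space K) scale1 (*)
       (\<lambda>a. \<Sum>y'\<in>K. \<Sum>y\<in>K. tcoeff t y y' * \<psi> a (?e x') (?e y) (?e y'))"
      unfolding linear_on_def
    proof (intro conjI ballI allI)
      fix a b :: "'b \<Rightarrow>\<^sub>0 'k" assume ab: "a \<in> free_space K" "b \<in> free_space K"
      show "(\<Sum>y'\<in>K. \<Sum>y\<in>K. tcoeff t y y' * \<psi> (a + b) (?e x') (?e y) (?e y')) =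
        (\<Sum>y'\<in>K. \<Sum>y\<in>K. tcoeff t y y' * \<psi> a (?e x') (?e y) (?e y')) +
        (\<Sum>y'\<in>K. \<Sum>y\<in>K. tcoeff t y y' * \<psi> b (?e x') (?e y) (?e y'))"
        unfolding sum.distrib[symmetric]
      proof (intro sum.cong refl)
        fix y' y assume "y' \<in> K" "y \<in> K"
        then show "tcoeff t y y' * \<psi> (a + b) (?e x') (?e y) (?e y') =
          tcoeff t y y' * \<psi> a (?e x') (?e y) (?e y') + tcoeff t y y' * \<psi> b (?e x') (?e y) (?e y')"
          using lin1[of x' y y'] x' ab by (simp add: linear_on_def algebra_simps)
      qed
    next
      fix c :: 'k and a :: "'b \<Rightarrow>\<^sub>0 'k" assume a: "a \<in> free_space K"
      show "(\<Sum>y'\<in>K. \<Sum>y\<in>K. tcoeff t y y' * \<psi> (scale1 c a) (?e x') (?e y) (?e y')) =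
        c * (\<Sum>y'\<in>K. \<Sum>y\<in>K. tcoeff t y y' * \<psi> a (?e x') (?e y) (?e y'))"
        unfolding sum_distrib_left
      proof (intro sum.cong refl)
        fix y' y assume "y' \<in> K" "y \<in> K"
        then show "tcoeff t y y' * \<psi> (scale1 c a) (?e x') (?e y) (?e y') =
          c * (tcoeff t y y' * \<psi> a (?e x') (?e y) (?e y'))"
          using lin1[of x' y y'] x' a by (simp add: linear_on_def algebra_simps)
      qed
    qed
  qed
  also have "\<dots> = (\<Sum>x\<in>K. \<Sum>x'\<in>K. \<Sum>y\<in>K. \<Sum>y'\<in>K. tcoeff s x x' * tcoeff t y y' *
      \<psi> (?e x) (?e x') (?e y) (?e y'))"
    by (subst sum.swap, intro sum.cong refl, subst sum.swap) (simp add: sum_distrib_left mult_ac)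
  also have "\<dots> = (\<Sum>x\<in>K. \<Sum>y\<in>K. \<Sum>x'\<in>K. \<Sum>y'\<in>K. tcoeff s x x' * tcoeff t y y' *
      \<psi> (?e x) (?e x') (?e y) (?e y'))"
    by (rule sum.cong[OF refl], rule sum.swap)
  finally show ?thesis
    by (simp only: sum.cartesian_product' fst_conv snd_conv)
qed

section \<open>Cocommutative elements of coquasitriangular Hopf algebras\<close>

lemma sum_times_product:
  fixes f g :: "_ \<Rightarrow> 'k::comm_semiring_0"
  shows "(\<Sum>p\<in>A \<times> B. f (fst p) * g (snd p)) = (\<Sum>x\<in>A. f x) * (\<Sum>y\<in>B. g y)"
  by (simp add: sum_product sum.cartesian_product case_prod_beta)

lemma linear_on_lookup:
  assumes "linear_on V s scale1 f"
  shows "linear_on V s (*) (\<lambda>a. Poly_Mapping.lookup (f a) w)"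
  using assms by (auto simp: linear_on_def lookup_add)

lemma linear_on_mult_left:
  assumes "linear_on V s (*) f"
  shows "linear_on V s (*) (\<lambda>a. f a * (c::'k::field))"
  using assms by (auto simp: linear_on_def algebra_simps)

lemma linear_on_mult_right:
  assumes "linear_on V s (*) f"
  shows "linear_on V s (*) (\<lambda>a. (c::'k::field) * f a)"
  using assms by (auto simp: linear_on_def algebra_simps)

lemma cocommutative_trace:
  assumes "coalgebra C" "finite K" "K \<subseteq> cbasis C" "a \<in> free_space K" "cocommutative C a"
  shows "(\<Sum>u\<in>K. Poly_Mapping.lookup a u * tcoeff (comul C (basis_vec u)) x y) =
    (\<Sum>u\<in>K. Poly_Mapping.lookup a u * tcoeff (comul C (basis_vec u)) y x)"
  using assms(5) comul_coeff_expand[OF assms(1-4)] by (simp add: cocommutative_def)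

text \<open>
  The tensor square of the span of \<open>K\<close> is a coalgebra with basis \<open>K \<times> K\<close>, and bilinear forms are its
  functionals. The braiding axiom states that, coefficient by coefficient, the form \<open>R\<close> conjugates
  the multiplication into the opposite multiplication, while \<open>a \<otimes> b\<close> is a trace on functionals.
\<close>

lemma cocommutative_elements_commute:
  fixes H :: "('b, 'k::field, 'm) hopf_scheme"
  assumes H: "coquasitriangular H" and K: "finite K" "K \<subseteq> cbasis H"
    and sub: "\<And>u. u \<in> K \<Longrightarrow> comul H (basis_vec u) \<in> tensor_space (free_space K) K"
    and a: "a \<in> free_space K" "cocommutative H a"
    and b: "b \<in> free_space K" "cocommutative H b"
  shows "hmul H a b = hmul H b a"
proof (rule poly_mapping_eqI)
  fix w
  let ?e = "basis_vec :: 'b \<Rightarrow> 'b \<Rightarrow>\<^sub>0 'k"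
  have hopf: "hopf_algebra H" using H by (simp add: coquasitriangular_def)
  then have C: "coalgebra H" by (simp add: hopf_algebra_def)
  obtain R where R: "bilinear_form H R" and inv: "convolution_invertible H R"
    and braid: "\<forall>a\<in>cspace H. \<forall>b\<in>cspace H.
        sweedler (comul H a) (\<lambda>a1 a2. sweedler (comul H b)
             (\<lambda>b1 b2. scale1 (R a1 b1) (hmul H a2 b2))) =
           sweedler (comul H a) (\<lambda>a1 a2. sweedler (comul H b)
             (\<lambda>b1 b2. scale1 (R a2 b2) (hmul H b1 a1)))"
    using H unfolding coquasitriangular_def by (elim conjE exE) (rule that)
  obtain Q where Q: "bilinear_form H Q"
    and RQ: "\<And>a b. a \<in> cspace H \<Longrightarrow> b \<in> cspace H \<Longrightarrow> convolution H R Q a b = counit H a * counit H b"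
    and QR: "\<And>a b. a \<in> cspace H \<Longrightarrow> b \<in> cspace H \<Longrightarrow> convolution H Q R a b = counit H a * counit H b"
    using inv unfolding convolution_invertible_def by auto
  have mul: "bilinear_on (cspace H) scale1 scale1 (hmul H)"
    using hopf by (simp add: hopf_algebra_def)
  have inH: "x \<in> cspace H" if "x \<in> free_space K" for x
    using that K(2) by (rule free_space_mono)
  have lin: "linear_on (free_space K) scale1 (*) (\<lambda>x. B x y)"
      "linear_on (free_space K) scale1 (*) (B y)"
    if B: "bilinear_on (cspace H) scale1 (*) B" and y: "y \<in> free_space K"
    for B :: "('b \<Rightarrow>\<^sub>0 'k) \<Rightarrow> ('b \<Rightarrow>\<^sub>0 'k) \<Rightarrow> 'k" and y
  proof -
    have B': "linear_on (cspace H) scale1 (*) (\<lambda>x. B x y)" "linear_on (cspace H) scale1 (*) (B y)"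
      using B inH[OF y] unfolding bilinear_on_def by blast+
    show "linear_on (free_space K) scale1 (*) (\<lambda>x. B x y)"
      "linear_on (free_space K) scale1 (*) (B y)"
      by (rule linear_on_free_space_subset[OF B'(1) K(2)], rule linear_on_free_space_subset[OF B'(2) K(2)])
  qed
  note Rlin = lin[OF R[unfolded bilinear_form_def]]
   and Qlin = lin[OF Q[unfolded bilinear_form_def]]
  have "bilinear_on (cspace H) scale1 (*) (\<lambda>x y. Poly_Mapping.lookup (hmul H x y) w)"
    using mul unfolding bilinear_on_def by (intro conjI ballI linear_on_lookup) blast+
  note Mlin = lin[OF this]
  define D where "D = (\<lambda>u. tcoeff (comul H (?e u)))"
  \<comment> \<open>structure constants, counit and functionals of the tensor square\<close>
  define D2 where "D2 = (\<lambda>u p q. D (fst u) (fst p) (fst q) * D (snd u) (snd p) (snd q))"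
  define e where "e = (\<lambda>u. counit H (?e (fst u)) * counit H (?e (snd u)))"
  define r where "r = (\<lambda>u. R (?e (fst u)) (?e (snd u)))"
  define q where "q = (\<lambda>u. Q (?e (fst u)) (?e (snd u)))"
  define m where "m = (\<lambda>u. Poly_Mapping.lookup (hmul H (?e (fst u)) (?e (snd u))) w)"
  define m' where "m' = (\<lambda>u. Poly_Mapping.lookup (hmul H (?e (snd u)) (?e (fst u))) w)"
  define \<gamma> where "\<gamma> = (\<lambda>u. Poly_Mapping.lookup a (fst u) * Poly_Mapping.lookup b (snd u))"
  note defs = D_def D2_def e_def r_def q_def m_def m'_def
  have ein: "?e (fst u) \<in> free_space K" "?e (snd u) \<in> free_space K" if "u \<in> K \<times> K" for u
    using that by auto
  have expand: "sweedler (comul H (?e (fst u))) (\<lambda>a1 a2. sweedler (comul H (?e (snd u)))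
        (\<lambda>b1 b2. \<psi> a1 a2 b1 b2)) =
      (\<Sum>p\<in>K \<times> K. \<Sum>q\<in>K \<times> K. D2 u p q *
         \<psi> (?e (fst p)) (?e (fst q)) (?e (snd p)) (?e (snd q)))"
    if "u \<in> K \<times> K"
      "\<And>x' y y'. x' \<in> K \<Longrightarrow> y \<in> K \<Longrightarrow> y' \<in> K \<Longrightarrow>
       linear_on (free_space K) scale1 (*) (\<lambda>a. \<psi> a (?e x') (?e y) (?e y'))"
      "\<And>a x' y'. a \<in> free_space K \<Longrightarrow> x' \<in> K \<Longrightarrow> y' \<in> K \<Longrightarrow>
       linear_on (free_space K) scale1 (*) (\<lambda>b. \<psi> a (?e x') b (?e y'))"
    for u and \<psi> :: "('b \<Rightarrow>\<^sub>0 'k) \<Rightarrow> ('b \<Rightarrow>\<^sub>0 'k) \<Rightarrow> ('b \<Rightarrow>\<^sub>0 'k) \<Rightarrow> ('b \<Rightarrow>\<^sub>0 'k) \<Rightarrow> 'k"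
    unfolding D2_def D_def using that
    by (intro double_sweedler_expand K sub) auto
  have conv_r_q: "conv (K \<times> K) D2 r q u = e u" if "u \<in> K \<times> K" for u
  proof -
    have "conv (K \<times> K) D2 r q u = convolution H R Q (?e (fst u)) (?e (snd u))"
      unfolding convolution_def
      by (subst expand[OF that]) (auto simp: conv_def r_def q_def mult.assoc
          intro!: linear_on_mult_left linear_on_mult_right Rlin Qlin)
    then show ?thesis using RQ inH ein[OF that] by (simp add: e_def)
  qed
  have conv_q_r: "conv (K \<times> K) D2 q r u = e u" if "u \<in> K \<times> K" for u
  proof -
    have "conv (K \<times> K) D2 q r u = convolution H Q R (?e (fst u)) (?e (snd u))"
      unfolding convolution_def
      by (subst expand[OF that]) (auto simp: conv_def r_def q_def mult.assoc
          intro!: linear_on_mult_left linear_on_mult_right Rlin Qlin)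
    then show ?thesis using QR inH ein[OF that] by (simp add: e_def)
  qed
  have conj: "conv (K \<times> K) D2 r m u = conv (K \<times> K) D2 m' r u" if "u \<in> K \<times> K" for u
  proof -
    let ?x = "?e (fst u)" and ?y = "?e (snd u)"
    have "conv (K \<times> K) D2 r m u = sweedler (comul H ?x) (\<lambda>a1 a2. sweedler (comul H ?y)
             (\<lambda>b1 b2. R a1 b1 * Poly_Mapping.lookup (hmul H a2 b2) w))"
      by (subst expand[OF that]) (auto simp: conv_def r_def m_def mult.assoc
          intro!: linear_on_mult_left linear_on_mult_right Rlin Mlin)
    also have "\<dots> = sweedler (comul H ?x) (\<lambda>a1 a2. sweedler (comul H ?y)
             (\<lambda>b1 b2. R a2 b2 * Poly_Mapping.lookup (hmul H b1 a1) w))"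
      using arg_cong[OF braid[rule_format, OF inH inH, OF ein[OF that]], of "\<lambda>t. Poly_Mapping.lookup t w"]
      by (simp only: lookup_sweedler lookup_scale1)
    also have "\<dots> = conv (K \<times> K) D2 m' r u"
      by (subst expand[OF that]) (auto simp: conv_def r_def m'_def mult_ac
          intro!: linear_on_mult_left linear_on_mult_right Rlin Mlin)
    finally show ?thesis .
  qed
  have unit: "conv (K \<times> K) D2 p e u = p u" if "u \<in> K \<times> K" for p u
  proof -
    have "(\<Sum>z\<in>K \<times> K. D2 u y z * e z) = (if y = u then 1 else 0)" if "y \<in> K \<times> K" for y
    proof -
      have "(\<Sum>z\<in>K \<times> K. D2 u y z * e z) =
          (\<Sum>z\<in>K \<times> K. (D (fst u) (fst y) (fst z) * counit H (?e (fst z))) *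
                        (D (snd u) (snd y) (snd z) * counit H (?e (snd z))))"
        by (simp add: D2_def e_def mult_ac)
      also have "\<dots> = (\<Sum>z\<in>K. D (fst u) (fst y) z * counit H (?e z)) *
                       (\<Sum>z\<in>K. D (snd u) (snd y) z * counit H (?e z))"
        by (subst sum_times_product[symmetric]) (rule refl)
      also have "\<dots> = (if fst y = fst u then 1 else 0) * (if snd y = snd u then 1 else 0)"
        using \<open>u \<in> K \<times> K\<close> \<open>y \<in> K \<times> K\<close> unfolding D_def
        by (intro arg_cong2[where f = "(*)"] counit_coeff[OF C K sub]) auto
      finally show ?thesis by (auto simp: prod_eq_iff)
    qed
    then have "(\<Sum>y\<in>K \<times> K. p y * (\<Sum>z\<in>K \<times> K. D2 u y z * e z)) =
        (\<Sum>y\<in>K \<times> K. if y = u then p y else 0)"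
      by (intro sum.cong refl) simp
    then show ?thesis using that K(1) by (simp add: conv_def sum_distrib_left mult_ac)
  qed
  have coassoc: "(\<Sum>t\<in>K \<times> K. D2 u t z * D2 t x y) = (\<Sum>t\<in>K \<times> K. D2 u x t * D2 t y z)"
    if "u \<in> K \<times> K" "x \<in> K \<times> K" "y \<in> K \<times> K" "z \<in> K \<times> K" for u x y z
  proof -
    have "(\<Sum>t\<in>K \<times> K. D2 u t z * D2 t x y) =
        (\<Sum>t\<in>K \<times> K. (D (fst u) (fst t) (fst z) * D (fst t) (fst x) (fst y)) *
                      (D (snd u) (snd t) (snd z) * D (snd t) (snd x) (snd y)))"
      by (simp add: D2_def mult_ac)
    also have "\<dots> = (\<Sum>t\<in>K. D (fst u) t (fst z) * D t (fst x) (fst y)) *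
                     (\<Sum>t\<in>K. D (snd u) t (snd z) * D t (snd x) (snd y))"
      by (subst sum_times_product[symmetric]) (rule refl)
    also have "\<dots> = (\<Sum>t\<in>K. D (fst u) (fst x) t * D t (fst y) (fst z)) *
                     (\<Sum>t\<in>K. D (snd u) (snd x) t * D t (snd y) (snd z))"
      using that unfolding D_def
      by (intro arg_cong2[where f = "(*)"] coassoc_coeff[OF C K sub]) auto
    also have "\<dots> = (\<Sum>t\<in>K \<times> K. (D (fst u) (fst x) (fst t) * D (fst t) (fst y) (fst z)) *
                      (D (snd u) (snd x) (snd t) * D (snd t) (snd y) (snd z)))"
      by (subst sum_times_product[symmetric]) (rule refl)
    also have "\<dots> = (\<Sum>t\<in>K \<times> K. D2 u x t * D2 t y z)"
      by (simp add: D2_def mult_ac)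
    finally show ?thesis .
  qed
  have trace: "(\<Sum>u\<in>K \<times> K. \<gamma> u * D2 u x y) = (\<Sum>u\<in>K \<times> K. \<gamma> u * D2 u y x)" for x y
  proof -
    have *: "(\<Sum>u\<in>K \<times> K. \<gamma> u * D2 u x y) =
        (\<Sum>u\<in>K. Poly_Mapping.lookup a u * D u (fst x) (fst y)) *
        (\<Sum>u\<in>K. Poly_Mapping.lookup b u * D u (snd x) (snd y))" for x y
      unfolding sum_times_product[symmetric] by (simp add: \<gamma>_def D2_def mult_ac)
    show ?thesis unfolding * unfolding D_def
      using cocommutative_trace[OF C K a] cocommutative_trace[OF C K b] by metis
  qed
  have coeff_hmul: "Poly_Mapping.lookup (hmul H x y) w =
      (\<Sum>u\<in>K. Poly_Mapping.lookup x u * (\<Sum>v\<in>K. Poly_Mapping.lookup y v *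
         Poly_Mapping.lookup (hmul H (?e u) (?e v)) w))"
    if "x \<in> free_space K" "y \<in> free_space K" for x y
  proof -
    have "Poly_Mapping.lookup (hmul H x y) w =
        (\<Sum>u\<in>K. Poly_Mapping.lookup x u * Poly_Mapping.lookup (hmul H (?e u) y) w)"
      using that K(1) by (intro linear_on_expand[OF Mlin(1)]) auto
    also have "\<dots> = (\<Sum>u\<in>K. Poly_Mapping.lookup x u * (\<Sum>v\<in>K. Poly_Mapping.lookup y v *
         Poly_Mapping.lookup (hmul H (?e u) (?e v)) w))"
    proof (rule sum.cong[OF refl])
      fix u assume "u \<in> K"
      then have "Poly_Mapping.lookup (hmul H (?e u) y) w = (\<Sum>v\<in>K. Poly_Mapping.lookup y v *
         Poly_Mapping.lookup (hmul H (?e u) (?e v)) w)"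
        using that K(1) by (intro linear_on_expand[OF Mlin(2)]) auto
      then show "Poly_Mapping.lookup x u * Poly_Mapping.lookup (hmul H (?e u) y) w =
          Poly_Mapping.lookup x u * (\<Sum>v\<in>K. Poly_Mapping.lookup y v *
         Poly_Mapping.lookup (hmul H (?e u) (?e v)) w)" by (rule arg_cong)
    qed
    finally show ?thesis .
  qed
  have "Poly_Mapping.lookup (hmul H a b) w = (\<Sum>u\<in>K \<times> K. \<gamma> u * m u)"
    unfolding coeff_hmul[OF a(1) b(1)]
    by (simp add: \<gamma>_def m_def sum_distrib_left sum.cartesian_product case_prod_beta mult_ac)
  also have "\<dots> = (\<Sum>u\<in>K \<times> K. \<gamma> u * m' u)"
    by (rule trace_of_conjugates[OF coassoc trace unit conv_r_q conv_q_r conj])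
  also have "\<dots> = (\<Sum>u\<in>K. \<Sum>v\<in>K. Poly_Mapping.lookup a u *
      (Poly_Mapping.lookup b v * Poly_Mapping.lookup (hmul H (?e v) (?e u)) w))"
    by (simp add: \<gamma>_def m'_def sum.cartesian_product case_prod_beta mult.assoc)
  also have "\<dots> = (\<Sum>v\<in>K. \<Sum>u\<in>K. Poly_Mapping.lookup a u *
      (Poly_Mapping.lookup b v * Poly_Mapping.lookup (hmul H (?e v) (?e u)) w))"
    by (rule sum.swap)
  also have "\<dots> = Poly_Mapping.lookup (hmul H b a) w"
    by (simp add: coeff_hmul[OF b(1) a(1)] sum_distrib_left mult.left_commute)
  finally show "Poly_Mapping.lookup (hmul H a b) w = Poly_Mapping.lookup (hmul H b a) w" .
qed

section \<open>Characters of comodules\<close>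

lemma (in vector_space) pscale_zero [simp]: "pscale scale 0 t = 0" "pscale scale c 0 = 0"
  by (auto intro!: poly_mapping_eqI simp: lookup_pscale)

lemma (in vector_space) linear_on_sum:
  assumes g: "linear_on V scale scale g" and V: "subspace V" and I: "finite I" "\<And>i. i \<in> I \<Longrightarrow> v i \<in> V"
  shows "g (\<Sum>i\<in>I. scale (c i) (v i)) = (\<Sum>i\<in>I. scale (c i) (g (v i)))"
  using I
proof (induction I)
  case empty
  have "g (scale 0 0) = scale 0 (g 0)"
    using g subspace_0[OF V] unfolding linear_on_def by blast
  then show ?case by simp
next
  case (insert j I)
  have mem: "scale (c j) (v j) \<in> V" "(\<Sum>i\<in>I. scale (c i) (v i)) \<in> V"
    using insert.prems V by (auto intro!: subspace_scale subspace_sum)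
  then have "g (scale (c j) (v j) + (\<Sum>i\<in>I. scale (c i) (v i))) =
      g (scale (c j) (v j)) + g (\<Sum>i\<in>I. scale (c i) (v i))"
    using g unfolding linear_on_def by blast
  moreover have "g (scale (c j) (v j)) = scale (c j) (g (v j))"
    using g insert.prems unfolding linear_on_def by blast
  ultimately show ?case using insert by simp
qed

lemma (in vector_space) independent_family_coeff_unique:
  assumes "finite I" "inj_on v I" "independent (v ` I)"
    and eq: "(\<Sum>i\<in>I. scale (c i) (v i)) = (\<Sum>i\<in>I. scale (d i) (v i))" and "k \<in> I"
  shows "c k = d k"
proof -
  have "(\<Sum>x\<in>v ` I. scale (c (inv_into I v x) - d (inv_into I v x)) x) =
      (\<Sum>i\<in>I. scale (c i - d i) (v i))"
    using assms(2) by (subst sum.reindex) auto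
  also have "\<dots> = 0"
    using eq by (simp add: scale_left_diff_distrib sum_subtractf)
  finally have "c (inv_into I v (v k)) - d (inv_into I v (v k)) = 0"
    using assms by (intro independentD[of "v ` I" "v ` I" "\<lambda>x. c (inv_into I v x) - d (inv_into I v x)"]) auto
  then show ?thesis using assms by simp
qed

text \<open>
  The coaction turns the coassociativity axiom of a comodule, taken at \<open>v\<^sub>i\<close>, into
  \<open>\<Sum>\<^sub>k v\<^sub>k \<otimes> (\<Sum>\<^sub>l c\<^sub>k\<^sub>l \<otimes> c\<^sub>l\<^sub>i) = \<Sum>\<^sub>k v\<^sub>k \<otimes> \<Delta> c\<^sub>k\<^sub>i\<close>, and the \<open>v\<^sub>k\<close> are linearly independent.
\<close>

lemma comul_matrix_coeff:
  fixes C :: "('b, 'k::field, 'm) coalg_scheme" and s :: "'k \<Rightarrow> 'v::ab_group_add \<Rightarrow> 'v"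
  assumes com: "right_comodule C s V \<rho>"
    and I: "finite I" "inj_on v I" "\<not> module.dependent s (v ` I)" "v ` I \<subseteq> V"
    and K: "finite K" "K \<subseteq> cbasis C" "\<And>l i. l \<in> I \<Longrightarrow> i \<in> I \<Longrightarrow> c l i \<in> free_space K"
    and rho: "\<And>i. i \<in> I \<Longrightarrow> \<rho> (v i) = (\<Sum>l\<in>I. tensor s (v l) (c l i))"
    and "k \<in> I" "i \<in> I"
  shows "tcoeff (comul C (c k i)) x y = (\<Sum>l\<in>I. Poly_Mapping.lookup (c k l) x * Poly_Mapping.lookup (c l i) y)"
proof -
  let ?e = "basis_vec :: 'b \<Rightarrow> 'b \<Rightarrow>\<^sub>0 'k"
  have C: "coalgebra C" and lin: "linear_on V s (pscale s) \<rho>"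
    using com by (simp_all add: right_comodule_def)
  interpret vector_space s using com by (simp add: right_comodule_def)
  have V: "subspace V" using com by (simp add: right_comodule_def)
  have lookup_rho: "Poly_Mapping.lookup (\<rho> (v i)) u = (\<Sum>l\<in>I. s (Poly_Mapping.lookup (c l i) u) (v l))"
    if "i \<in> I" for i u
    using that by (simp add: rho lookup_sum lookup_tensor)
  have lin_x: "linear_on V s s (\<lambda>w. Poly_Mapping.lookup (\<rho> w) x)"
    using lin by (auto simp: linear_on_def lookup_add lookup_pscale)
  have rho0: "Poly_Mapping.lookup (\<rho> 0) x = 0"
    using linear_on_sum[OF lin_x V, of "{}"] by simp
  let ?P = "\<lambda>u. Poly_Mapping.lookup (\<rho> (v i)) u"
  have keys: "Poly_Mapping.keys (\<rho> (v i)) \<subseteq> K"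
  proof
    fix u assume "u \<in> Poly_Mapping.keys (\<rho> (v i))"
    then have "(\<Sum>l\<in>I. s (Poly_Mapping.lookup (c l i) u) (v l)) \<noteq> 0"
      unfolding lookup_rho[OF \<open>i \<in> I\<close>, symmetric] by (simp add: in_keys_iff)
    then obtain l where "l \<in> I" "s (Poly_Mapping.lookup (c l i) u) (v l) \<noteq> 0"
      by (rule sum.not_neutral_contains_not_neutral)
    then have "Poly_Mapping.lookup (c l i) u \<noteq> 0"
      by auto
    then show "u \<in> K" using free_space_lookup[OF K(3)[OF \<open>l \<in> I\<close> \<open>i \<in> I\<close>], of u] by metis
  qed
  have "v i \<in> V" using I(4) \<open>i \<in> I\<close> by blast
  then have coassoc: "sweedler (\<rho> (v i)) (\<lambda>v0 v1. tensor (pscale s) (\<rho> v0) (v1 :: 'b \<Rightarrow>\<^sub>0 'k)) =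
        sweedler (\<rho> (v i)) (\<lambda>v0 v1. sweedler (comul C v1)
          (\<lambda>v1' v1''. tensor (pscale s) (tensor s v0 v1') v1''))" (is "?A = ?B")
    using com unfolding right_comodule_def by (elim conjE) (rule bspec)
  have single_sum: "(\<Sum>u\<in>L. s (Poly_Mapping.lookup (?e u) y) (h u)) = (if y \<in> L then h y else 0)"
    if "finite L" for L h
  proof -
    have "(\<Sum>u\<in>L. s (Poly_Mapping.lookup (?e u) y) (h u)) = (\<Sum>u\<in>L. if u = y then h u else 0)"
      by (intro sum.cong refl) (simp add: lookup_single when_def)
    then show ?thesis using that by (simp add: sum.delta')
  qed
  \<comment> \<open>the coefficients of \<open>x \<otimes> y\<close> on the two sides of coassociativity are vectors in \<open>V\<close>\<close>
  have "Poly_Mapping.lookup (Poly_Mapping.lookup ?A y) x =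
      (\<Sum>u\<in>Poly_Mapping.keys (\<rho> (v i)). s (Poly_Mapping.lookup (?e u) y) (Poly_Mapping.lookup (\<rho> (?P u)) x))"
    by (simp add: sweedler_def lookup_sum lookup_tensor lookup_pscale)
  also have "\<dots> = Poly_Mapping.lookup (\<rho> (?P y)) x"
    using rho0 by (auto simp: single_sum in_keys_iff)
  also have "\<dots> = (\<Sum>l\<in>I. s (Poly_Mapping.lookup (c l i) y) (Poly_Mapping.lookup (\<rho> (v l)) x))"
    unfolding lookup_rho[OF \<open>i \<in> I\<close>] using I by (intro linear_on_sum[OF lin_x V]) auto
  also have "\<dots> = (\<Sum>l\<in>I. \<Sum>k\<in>I. s (Poly_Mapping.lookup (c k l) x * Poly_Mapping.lookup (c l i) y) (v k))"
    by (intro sum.cong refl) (simp add: lookup_rho scale_sum_right mult.commute)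
  also have "\<dots> = (\<Sum>k\<in>I. s (\<Sum>l\<in>I. Poly_Mapping.lookup (c k l) x * Poly_Mapping.lookup (c l i) y) (v k))"
    by (subst sum.swap) (simp add: scale_sum_left)
  finally have left: "Poly_Mapping.lookup (Poly_Mapping.lookup ?A y) x = \<dots>" .
  have inner: "Poly_Mapping.lookup (Poly_Mapping.lookup (sweedler t
      (\<lambda>a b. tensor (pscale s) (tensor s q a) b)) y) x = s (tcoeff t x y) q" for t :: "'b \<Rightarrow>\<^sub>0 'b \<Rightarrow>\<^sub>0 'k" and q
  proof -
    have "Poly_Mapping.lookup (Poly_Mapping.lookup (sweedler t
      (\<lambda>a b. tensor (pscale s) (tensor s q a) b)) y) x =
      (\<Sum>u\<in>Poly_Mapping.keys t. s (Poly_Mapping.lookup (?e u) y) (s (tcoeff t x u) q))"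
      by (simp add: sweedler_def lookup_sum lookup_tensor lookup_pscale)
    also have "\<dots> = s (tcoeff t x y) q"
      by (auto simp: single_sum in_keys_iff simp del: scale_scale)
    finally show ?thesis .
  qed
  have "Poly_Mapping.lookup (Poly_Mapping.lookup ?B y) x =
      (\<Sum>u\<in>Poly_Mapping.keys (\<rho> (v i)). s (tcoeff (comul C (?e u)) x y) (?P u))"
    unfolding sweedler_def[of "\<rho> (v i)"] lookup_sum inner ..
  also have "\<dots> = (\<Sum>u\<in>K. s (tcoeff (comul C (?e u)) x y) (?P u))"
    using K(1) keys by (intro sum.mono_neutral_left) (auto simp: in_keys_iff)
  also have "\<dots> = (\<Sum>u\<in>K. \<Sum>k\<in>I. s (Poly_Mapping.lookup (c k i) u * tcoeff (comul C (?e u)) x y) (v k))"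
    by (intro sum.cong refl) (simp add: lookup_rho[OF \<open>i \<in> I\<close>] scale_sum_right mult.commute)
  also have "\<dots> = (\<Sum>k\<in>I. s (\<Sum>u\<in>K. Poly_Mapping.lookup (c k i) u * tcoeff (comul C (?e u)) x y) (v k))"
    by (subst sum.swap) (simp add: scale_sum_left)
  also have "\<dots> = (\<Sum>k\<in>I. s (tcoeff (comul C (c k i)) x y) (v k))"
    using K(3) \<open>i \<in> I\<close> by (intro sum.cong refl) (simp add: comul_coeff_expand[OF C K(1,2)])
  finally have right: "Poly_Mapping.lookup (Poly_Mapping.lookup ?B y) x = \<dots>" .
  have "(\<Sum>k\<in>I. s (tcoeff (comul C (c k i)) x y) (v k)) =
     (\<Sum>k\<in>I. s (\<Sum>l\<in>I. Poly_Mapping.lookup (c k l) x * Poly_Mapping.lookup (c l i) y) (v k))"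
    unfolding left[symmetric] right[symmetric] coassoc ..
  from independent_family_coeff_unique[OF I(1-3) this \<open>k \<in> I\<close>] show ?thesis .
qed

lemma free_space_sum:
  assumes "\<And>i. i \<in> I \<Longrightarrow> c i \<in> free_space K"
  shows "(\<Sum>i\<in>I. c i) \<in> free_space K"
proof -
  have "Poly_Mapping.lookup (\<Sum>i\<in>I. c i) x = 0" if "x \<notin> K" for x
    unfolding lookup_sum using assms that by (intro sum.neutral ballI) (blast intro: free_space_lookup)
  then show ?thesis by (auto simp: free_space_def in_keys_iff)
qed

text \<open>
  By the formula for \<open>\<Delta> c\<^sub>i\<^sub>i\<close>, the coefficient of \<open>x \<otimes> y\<close> is the trace of the product of two
  matrices, and this does not depend on their order.
\<close>

lemma comodule_character_cocommutative:
  fixes C :: "('b, 'k::field, 'm) coalg_scheme" and s :: "'k \<Rightarrow> 'v::ab_group_add \<Rightarrow> 'v"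
  assumes com: "right_comodule C s V \<rho>"
    and I: "finite I" "inj_on v I" "\<not> module.dependent s (v ` I)" "v ` I \<subseteq> V"
    and K: "finite K" "K \<subseteq> cbasis C" "\<And>l i. l \<in> I \<Longrightarrow> i \<in> I \<Longrightarrow> c l i \<in> free_space K"
    and rho: "\<And>i. i \<in> I \<Longrightarrow> \<rho> (v i) = (\<Sum>l\<in>I. tensor s (v l) (c l i))"
  shows "cocommutative C (\<Sum>i\<in>I. c i i)"
proof -
  have C: "coalgebra C" using com by (simp add: right_comodule_def)
  have mem: "(\<Sum>i\<in>I. c i i) \<in> free_space K"
    using K(3) by (intro free_space_sum)
  have "tcoeff (comul C (\<Sum>i\<in>I. c i i)) x y =
      (\<Sum>i\<in>I. \<Sum>l\<in>I. Poly_Mapping.lookup (c i l) x * Poly_Mapping.lookup (c l i) y)" for x y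
  proof -
    have "tcoeff (comul C (\<Sum>i\<in>I. c i i)) x y =
        (\<Sum>u\<in>K. \<Sum>i\<in>I. Poly_Mapping.lookup (c i i) u * tcoeff (comul C (basis_vec u)) x y)"
      by (simp add: comul_coeff_expand[OF C K(1,2) mem] lookup_sum sum_distrib_right)
    also have "\<dots> = (\<Sum>i\<in>I. tcoeff (comul C (c i i)) x y)"
      using K(3) by (subst sum.swap) (simp add: comul_coeff_expand[OF C K(1,2)])
    finally show ?thesis
      by (simp add: comul_matrix_coeff[OF com I K rho])
  qed
  moreover have "(\<Sum>i\<in>I. \<Sum>l\<in>I. Poly_Mapping.lookup (c i l) x * Poly_Mapping.lookup (c l i) y) =
      (\<Sum>i\<in>I. \<Sum>l\<in>I. Poly_Mapping.lookup (c i l) y * Poly_Mapping.lookup (c l i) x)" for x y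
    by (subst sum.swap) (simp add: mult.commute)
  ultimately show ?thesis
    by (simp only: cocommutative_def simp_thms)
qed

section \<open>Coefficients of explicit linear combinations\<close>

lemma tensor_space_coeffI:
  fixes t :: "'b \<Rightarrow>\<^sub>0 'b \<Rightarrow>\<^sub>0 'k::field"
  assumes "\<And>p q. tcoeff t p q \<noteq> 0 \<Longrightarrow> p \<in> K \<and> q \<in> K"
  shows "t \<in> tensor_space (free_space K) K"
proof -
  have "Poly_Mapping.lookup t q = 0" if "q \<notin> K" for q
    by (rule poly_mapping_eqI) (use assms that in \<open>metis lookup_zero\<close>)
  then have "Poly_Mapping.keys t \<subseteq> K" by (meson in_keys_iff subsetI)
  moreover have "Poly_Mapping.keys (Poly_Mapping.lookup t q) \<subseteq> K" for q
    using assms by (meson in_keys_iff subsetI)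
  ultimately show ?thesis
    unfolding tensor_space_def free_space_def by blast
qed

lemma lookup_combination:
  fixes X :: "'b \<Rightarrow> 'k::field"
  assumes "finite K"
  shows "Poly_Mapping.lookup (\<Sum>u\<in>K. scale1 (X u) (basis_vec u)) z = (if z \<in> K then X z else 0)"
proof -
  have "(\<Sum>u\<in>K. X u * Poly_Mapping.lookup (basis_vec u) z) = (\<Sum>u\<in>K. if u = z then X u else 0)"
    by (intro sum.cong refl) (simp add: lookup_single when_def)
  then show ?thesis using assms by (simp add: lookup_sum sum.delta')
qed

lemma combination_in_free_space:
  fixes X :: "'b \<Rightarrow> 'k::field"
  assumes "finite K"
  shows "(\<Sum>u\<in>K. scale1 (X u) (basis_vec u)) \<in> free_space K"
  using lookup_combination[OF assms, of X] by (auto simp: free_space_def in_keys_iff split: if_splits)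

section \<open>Twisted coalgebras of functions on stabilizers\<close>

context group
begin

lemma twisted_coalg_comul_coeff:
  fixes \<tau> :: "'a \<Rightarrow> 'a \<Rightarrow> 'f \<Rightarrow> 'k::field"
  assumes S: "finite (stabilizer G lact f)" "subgroup (stabilizer G lact f) G"
    and xy: "x \<in> stabilizer G lact f" "y \<in> stabilizer G lact f"
  shows "tcoeff (comul (twisted_stabilizer_coalg G lact \<tau> f)
      (\<Sum>g\<in>stabilizer G lact f. scale1 (A g) (basis_vec g))) y x = \<tau> y x f * A (y \<otimes> x)"
proof -
  let ?S = "stabilizer G lact f"
  have SG: "g \<in> carrier G" if "g \<in> ?S" for g
    using that subgroup.subset[OF S(2)] by blast
  have yx: "y \<otimes> x \<in> ?S"
    using xy subgroup.m_closed[OF S(2)] by blast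
  have delta: "(\<Sum>t\<in>?S. \<tau> (g \<otimes> inv t) t f *
       (Poly_Mapping.lookup (basis_vec t) x * Poly_Mapping.lookup (basis_vec (g \<otimes> inv t)) y)) =
     (if g = y \<otimes> x then \<tau> y x f else 0)" if "g \<in> ?S" for g
  proof -
    have "(\<Sum>t\<in>?S. \<tau> (g \<otimes> inv t) t f *
       (Poly_Mapping.lookup (basis_vec t) x * Poly_Mapping.lookup (basis_vec (g \<otimes> inv t)) y)) =
       (\<Sum>t\<in>?S. if t = x then \<tau> (g \<otimes> inv x) x f * (if g \<otimes> inv x = y then 1 else 0) else 0)"
      by (intro sum.cong refl) (auto simp: lookup_single when_def)
    also have "\<dots> = \<tau> (g \<otimes> inv x) x f * (if g \<otimes> inv x = y then 1 else 0)"
      using S(1) xy(1) by (simp add: sum.delta')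
    also have "g \<otimes> inv x = y \<longleftrightarrow> g = y \<otimes> x"
      using SG[OF that] SG[OF xy(1)] SG[OF xy(2)] by (metis inv_solve_right')
    finally show ?thesis using SG[OF xy(1)] SG[OF xy(2)] by (auto simp: m_assoc)
  qed
  have "tcoeff (comul (twisted_stabilizer_coalg G lact \<tau> f)
      (\<Sum>g\<in>?S. scale1 (A g) (basis_vec g))) y x =
      (\<Sum>g\<in>?S. A g * (\<Sum>t\<in>?S. \<tau> (g \<otimes> inv t) t f *
       (Poly_Mapping.lookup (basis_vec t) x * Poly_Mapping.lookup (basis_vec (g \<otimes> inv t)) y)))"
    unfolding twisted_stabilizer_coalg_def coalg.simps
      lookup_linear_ext2[OF S(1) combination_in_free_space[OF S(1)]]
    by (intro sum.cong refl) (simp add: lookup_combination[OF S(1)], simp add: lookup_sum)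
  also have "\<dots> = (\<Sum>g\<in>?S. if g = y \<otimes> x then A g * \<tau> y x f else 0)"
    by (intro sum.cong refl) (simp add: delta)
  also have "\<dots> = \<tau> y x f * A (y \<otimes> x)"
    using S(1) yx by (simp add: sum.delta')
  finally show ?thesis .
qed

lemma comodule_trace_twisted:
  fixes \<tau> :: "'a \<Rightarrow> 'a \<Rightarrow> 'f \<Rightarrow> 'k::field" and s :: "'k \<Rightarrow> 'v::ab_group_add \<Rightarrow> 'v"
  assumes S: "finite (stabilizer G lact f)" "subgroup (stabilizer G lact f) G"
    and com: "right_comodule (twisted_stabilizer_coalg G lact \<tau> f) s V \<rho>"
    and I: "finite I" "inj_on v I" "\<not> module.dependent s (v ` I)" "v ` I \<subseteq> V"
    and rho: "\<And>i. i \<in> I \<Longrightarrow> \<rho> (v i) =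
      (\<Sum>l\<in>I. tensor s (v l) (\<Sum>g\<in>stabilizer G lact f. scale1 (a l i g) (basis_vec g)))"
    and xy: "x \<in> stabilizer G lact f" "y \<in> stabilizer G lact f"
  shows "\<tau> y x f * (\<Sum>i\<in>I. a i i (y \<otimes> x)) = \<tau> x y f * (\<Sum>i\<in>I. a i i (x \<otimes> y))"
proof -
  let ?S = "stabilizer G lact f" and ?C = "twisted_stabilizer_coalg G lact \<tau> f"
  let ?c = "\<lambda>l i. \<Sum>g\<in>?S. scale1 (a l i g) (basis_vec g)"
  let ?\<chi> = "\<Sum>g\<in>?S. scale1 (\<Sum>i\<in>I. a i i g) (basis_vec g)"
  have "cocommutative ?C (\<Sum>i\<in>I. ?c i i)"
    by (rule comodule_character_cocommutative[OF com I S(1) _ _ rho])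
       (auto simp: twisted_stabilizer_coalg_def intro: combination_in_free_space[OF S(1)])
  moreover have "(\<Sum>i\<in>I. ?c i i) = ?\<chi>"
  proof (rule poly_mapping_eqI)
    fix z
    show "Poly_Mapping.lookup (\<Sum>i\<in>I. ?c i i) z =
      Poly_Mapping.lookup ?\<chi> z"
      unfolding lookup_sum[of _ I] lookup_combination[OF S(1)] by simp
  qed
  ultimately have "cocommutative ?C ?\<chi>" by (simp only:)
  then have "tcoeff (comul ?C ?\<chi>) y x = tcoeff (comul ?C ?\<chi>) x y"
    unfolding cocommutative_def by blast
  then show ?thesis
    by (simp only: twisted_coalg_comul_coeff[OF S xy] twisted_coalg_comul_coeff[OF S xy(2,1)])
qed

end

text \<open>
  The coalgebra of functions on a group is thus the twisted coalgebra of a trivial action with a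
  trivial cocycle, so that characters of both kinds of comodules are covered by
  \<open>comodule_trace_twisted\<close>.
\<close>

lemma function_coalg_eq_twisted:
  "function_coalg G = twisted_stabilizer_coalg G (\<lambda>g x. x) (\<lambda>g h x. 1) u"
proof -
  have "scale2 1 t = t" for t :: "'a \<Rightarrow>\<^sub>0 'a \<Rightarrow>\<^sub>0 'b"
    by (intro poly_mapping_eqI) simp
  then show ?thesis
    by (simp add: function_coalg_def twisted_stabilizer_coalg_def stabilizer_def)
qed

section \<open>Induction of twisted class functions\<close>

context matched_pair
begin

lemma lact_unit: "g \<in> carrier G \<Longrightarrow> g \<triangleright> \<one>\<^bsub>F\<^esub> = \<one>\<^bsub>F\<^esub>"
  using lact_prod[of g "\<one>\<^bsub>F\<^esub>" "\<one>\<^bsub>F\<^esub>"] lact_closed[of g "\<one>\<^bsub>F\<^esub>"] by (simp add: ract_one)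

lemma lact_inv: "g \<in> carrier G \<Longrightarrow> f \<in> carrier F \<Longrightarrow> inv\<^bsub>G\<^esub> g \<triangleright> (g \<triangleright> f) = f"
  using lact_mult[of "inv\<^bsub>G\<^esub> g" g f] by (simp add: lact_one)

lemma subgroup_stabilizer:
  assumes "f \<in> carrier F"
  shows "subgroup (stabilizer G (\<triangleright>) f) G"
proof
  show "inv\<^bsub>G\<^esub> x \<in> stabilizer G (\<triangleright>) f" if "x \<in> stabilizer G (\<triangleright>) f" for x
    using that assms lact_inv[of x f] by (auto simp: stabilizer_def)
qed (use assms in \<open>auto simp: stabilizer_def lact_one lact_mult\<close>)

end

context matched_pair_cocycles
begin

text \<open>
  View \<open>p\<close>, \<open>x\<close>, \<open>k\<close> as arrows \<open>f \<rightarrow> f\<^sub>1 \<rightarrow> f\<^sub>2 \<rightarrow> f\<close> of the action groupoid, with \<open>\<tau>\<close> as a 2-cocycle on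
  it. The product of the cocycle identities for the three cyclic rotations of this loop contains
  \<open>\<tau> k x\<close>, \<open>\<tau> x p\<close> and \<open>\<tau> p k\<close> on both sides, and the other six factors remain.
\<close>

lemma tau_cyclic:
  assumes G: "p \<in> carrier G" "x \<in> carrier G" "k \<in> carrier G" and f: "f \<in> carrier F"
    and loop: "k \<triangleright> (x \<triangleright> (p \<triangleright> f)) = f"
  shows "\<tau> (k \<otimes>\<^bsub>G\<^esub> x) p f * \<tau> (x \<otimes>\<^bsub>G\<^esub> p) k (x \<triangleright> (p \<triangleright> f)) * \<tau> (p \<otimes>\<^bsub>G\<^esub> k) x (p \<triangleright> f) =
    \<tau> k (x \<otimes>\<^bsub>G\<^esub> p) f * \<tau> x (p \<otimes>\<^bsub>G\<^esub> k) (x \<triangleright> (p \<triangleright> f)) * \<tau> p (k \<otimes>\<^bsub>G\<^esub> x) (p \<triangleright> f)"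
proof -
  let ?f1 = "p \<triangleright> f" and ?f2 = "x \<triangleright> (p \<triangleright> f)"
  have F: "?f1 \<in> carrier F" "?f2 \<in> carrier F" using G f by (simp_all add: lact_closed)
  have 1: "\<tau> k x ?f1 * \<tau> (k \<otimes>\<^bsub>G\<^esub> x) p f = \<tau> k (x \<otimes>\<^bsub>G\<^esub> p) f * \<tau> x p f"
    using tau_cocycle[of k x p f] G f by simp
  have 2: "\<tau> x p f * \<tau> (x \<otimes>\<^bsub>G\<^esub> p) k ?f2 = \<tau> x (p \<otimes>\<^bsub>G\<^esub> k) ?f2 * \<tau> p k ?f2"
    using tau_cocycle[of x p k ?f2] G F loop by simp
  have 3: "\<tau> p k ?f2 * \<tau> (p \<otimes>\<^bsub>G\<^esub> k) x ?f1 = \<tau> p (k \<otimes>\<^bsub>G\<^esub> x) ?f1 * \<tau> k x ?f1"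
    using tau_cocycle[of p k x ?f1] G F by simp
  have nz: "\<tau> k x ?f1 * \<tau> x p f * \<tau> p k ?f2 \<noteq> 0"
    using G F f by (simp add: tau_nonzero)
  have "(\<tau> k x ?f1 * \<tau> x p f * \<tau> p k ?f2) *
      (\<tau> (k \<otimes>\<^bsub>G\<^esub> x) p f * \<tau> (x \<otimes>\<^bsub>G\<^esub> p) k ?f2 * \<tau> (p \<otimes>\<^bsub>G\<^esub> k) x ?f1) =
      (\<tau> k x ?f1 * \<tau> (k \<otimes>\<^bsub>G\<^esub> x) p f) * (\<tau> x p f * \<tau> (x \<otimes>\<^bsub>G\<^esub> p) k ?f2) *
      (\<tau> p k ?f2 * \<tau> (p \<otimes>\<^bsub>G\<^esub> k) x ?f1)"
    by (simp add: mult_ac)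
  also have "\<dots> = (\<tau> k x ?f1 * \<tau> x p f * \<tau> p k ?f2) *
      (\<tau> k (x \<otimes>\<^bsub>G\<^esub> p) f * \<tau> x (p \<otimes>\<^bsub>G\<^esub> k) ?f2 * \<tau> p (k \<otimes>\<^bsub>G\<^esub> x) ?f1)"
    unfolding 1 2 3 by (simp add: mult_ac)
  finally show ?thesis using nz by (metis mult_cancel_left)
qed

text \<open>
  A trace on the \<open>\<tau>\<close>-twisted algebra of the action groupoid over \<open>\<Omega>\<close> vanishes on arrows that are not
  loops, and it takes the same value on the two products of arrows \<open>x\<close> and \<open>y\<close> that form a loop.
\<close>

definition twisted_class_function :: "'f set \<Rightarrow> ('g \<Rightarrow> 'f \<Rightarrow> 'k) \<Rightarrow> bool" where
  "twisted_class_function \<Omega> X \<longleftrightarrow>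
     (\<forall>h\<in>carrier G. \<forall>f\<in>\<Omega>. h \<triangleright> f \<noteq> f \<longrightarrow> X h f = 0) \<and>
     (\<forall>x\<in>carrier G. \<forall>y\<in>carrier G. \<forall>f\<in>\<Omega>. y \<triangleright> (x \<triangleright> f) = f \<longrightarrow>
        \<tau> y x f * X (y \<otimes>\<^bsub>G\<^esub> x) f = \<tau> x y (x \<triangleright> f) * X (x \<otimes>\<^bsub>G\<^esub> y) (x \<triangleright> f))"

text \<open>
  The formula for induced characters. An arrow \<open>p\<close> from \<open>f\<close> to \<open>f'\<close> carries loops at \<open>f'\<close> to loops
  at \<open>f\<close>, and the quotient of values of \<open>\<tau>\<close> is the scalar by which conjugation with \<open>p\<close> acts in the
  twisted groupoid algebra. The sum is over all \<open>p\<close> and not over coset representatives, so that it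
  involves no choice; the price is a factor, the order of the stabilizer of \<open>f\<close>.
\<close>

definition induce :: "'f \<Rightarrow> ('g \<Rightarrow> 'k) \<Rightarrow> 'g \<Rightarrow> 'f \<Rightarrow> 'k" where
  "induce f A h f' = (if h \<triangleright> f' = f' then
     \<Sum>p\<in>{p \<in> carrier G. p \<triangleright> f = f'}. \<tau> (inv\<^bsub>G\<^esub> p \<otimes>\<^bsub>G\<^esub> h) p f / \<tau> p (inv\<^bsub>G\<^esub> p \<otimes>\<^bsub>G\<^esub> h) f' *
       A (inv\<^bsub>G\<^esub> p \<otimes>\<^bsub>G\<^esub> h \<otimes>\<^bsub>G\<^esub> p) else 0)"

text \<open>
  The arrows \<open>p\<close> from \<open>f\<close> to \<open>f'\<close> and those from \<open>f\<close> to \<open>x \<triangleright> f'\<close> correspond under \<open>p \<mapsto> x p\<close>, and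
  the corresponding summands agree by \<open>tau_cyclic\<close>.
\<close>

lemma twisted_class_function_induce:
  assumes f: "f \<in> carrier F"
  shows "twisted_class_function (carrier F) (induce f A)"
  unfolding twisted_class_function_def
proof (intro conjI ballI impI)
  fix x y f' assume G: "x \<in> carrier G" "y \<in> carrier G" and f': "f' \<in> carrier F"
    and loop: "y \<triangleright> (x \<triangleright> f') = f'"
  let ?T = "\<lambda>f'. {p \<in> carrier G. p \<triangleright> f = f'}"
  let ?t = "\<lambda>h f' p. \<tau> (inv\<^bsub>G\<^esub> p \<otimes>\<^bsub>G\<^esub> h) p f / \<tau> p (inv\<^bsub>G\<^esub> p \<otimes>\<^bsub>G\<^esub> h) f' *
       A (inv\<^bsub>G\<^esub> p \<otimes>\<^bsub>G\<^esub> h \<otimes>\<^bsub>G\<^esub> p)"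
  have loops: "(y \<otimes>\<^bsub>G\<^esub> x) \<triangleright> f' = f'" "(x \<otimes>\<^bsub>G\<^esub> y) \<triangleright> (x \<triangleright> f') = x \<triangleright> f'"
    using loop G f' by (simp_all add: lact_mult lact_closed)
  have transport: "bij_betw (\<lambda>p. x \<otimes>\<^bsub>G\<^esub> p) (?T f') (?T (x \<triangleright> f'))"
    by (rule bij_betw_byWitness[where f' = "\<lambda>p. inv\<^bsub>G\<^esub> x \<otimes>\<^bsub>G\<^esub> p"])
       (use G f f' in \<open>auto simp: lact_mult lact_inv G.m_assoc[symmetric]\<close>)
  have summand: "\<tau> y x f' * ?t (y \<otimes>\<^bsub>G\<^esub> x) f' p =
      \<tau> x y (x \<triangleright> f') * ?t (x \<otimes>\<^bsub>G\<^esub> y) (x \<triangleright> f') (x \<otimes>\<^bsub>G\<^esub> p)" if "p \<in> ?T f'" for p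
  proof -
    have p: "p \<in> carrier G" "p \<triangleright> f = f'" using that by auto
    \<comment> \<open>the arrow that closes the loop \<open>f \<rightarrow> f' \<rightarrow> x \<triangleright> f' \<rightarrow> f\<close>\<close>
    define k where "k = inv\<^bsub>G\<^esub> p \<otimes>\<^bsub>G\<^esub> y"
    have k: "k \<in> carrier G" "y = p \<otimes>\<^bsub>G\<^esub> k"
      using p G by (simp_all add: k_def G.m_assoc[symmetric])
    have kloop: "k \<triangleright> (x \<triangleright> (p \<triangleright> f)) = f"
      using p G f f' loop lact_inv[of p f] by (simp add: k_def lact_mult lact_closed)
    have eqs: "inv\<^bsub>G\<^esub> p \<otimes>\<^bsub>G\<^esub> (y \<otimes>\<^bsub>G\<^esub> x) = k \<otimes>\<^bsub>G\<^esub> x"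
      "inv\<^bsub>G\<^esub> (x \<otimes>\<^bsub>G\<^esub> p) \<otimes>\<^bsub>G\<^esub> (x \<otimes>\<^bsub>G\<^esub> y) = k"
      using p G by (simp_all add: k_def G.m_assoc G.inv_mult_group)
         (simp add: G.m_assoc[symmetric])
    have nz: "\<tau> p (k \<otimes>\<^bsub>G\<^esub> x) f' \<noteq> 0" "\<tau> (x \<otimes>\<^bsub>G\<^esub> p) k (x \<triangleright> f') \<noteq> 0"
      using p G k f' by (simp_all add: tau_nonzero lact_closed)
    have eq: "\<tau> y x f' * (\<tau> (k \<otimes>\<^bsub>G\<^esub> x) p f / \<tau> p (k \<otimes>\<^bsub>G\<^esub> x) f') =
       \<tau> x y (x \<triangleright> f') * (\<tau> k (x \<otimes>\<^bsub>G\<^esub> p) f / \<tau> (x \<otimes>\<^bsub>G\<^esub> p) k (x \<triangleright> f'))"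
      using tau_cyclic[OF p(1) G(1) k(1) f kloop] nz by (simp add: p(2) k(2)[symmetric] field_simps)
    have "k \<otimes>\<^bsub>G\<^esub> x \<otimes>\<^bsub>G\<^esub> p = k \<otimes>\<^bsub>G\<^esub> (x \<otimes>\<^bsub>G\<^esub> p)"
      using p G k by (simp add: G.m_assoc)
    then show ?thesis unfolding eqs mult.assoc[symmetric, where ?'a = 'k] eq[unfolded mult.assoc[symmetric, where ?'a = 'k]]
      by (simp only:)
  qed
  have "\<tau> y x f' * induce f A (y \<otimes>\<^bsub>G\<^esub> x) f' = (\<Sum>p\<in>?T f'. \<tau> y x f' * ?t (y \<otimes>\<^bsub>G\<^esub> x) f' p)"
    by (simp add: induce_def loops sum_distrib_left)
  also have "\<dots> = (\<Sum>p\<in>?T f'. \<tau> x y (x \<triangleright> f') * ?t (x \<otimes>\<^bsub>G\<^esub> y) (x \<triangleright> f') (x \<otimes>\<^bsub>G\<^esub> p))"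
    by (rule sum.cong[OF refl summand])
  also have "\<dots> = (\<Sum>p\<in>?T (x \<triangleright> f'). \<tau> x y (x \<triangleright> f') * ?t (x \<otimes>\<^bsub>G\<^esub> y) (x \<triangleright> f') p)"
    by (rule sum.reindex_bij_betw[OF transport])
  also have "\<dots> = \<tau> x y (x \<triangleright> f') * induce f A (x \<otimes>\<^bsub>G\<^esub> y) (x \<triangleright> f')"
    by (simp add: induce_def loops sum_distrib_left)
  finally show "\<tau> y x f' * induce f A (y \<otimes>\<^bsub>G\<^esub> x) f' =
    \<tau> x y (x \<triangleright> f') * induce f A (x \<otimes>\<^bsub>G\<^esub> y) (x \<triangleright> f')" .
qed (simp add: induce_def)

text \<open>
  For \<open>p\<close> in the stabilizer, the trace property of \<open>A\<close> for the factorisation \<open>g = p (p\<inverse> g)\<close> says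
  that the summand of \<open>p\<close> is \<open>A g\<close>.
\<close>

lemma induce_at_base:
  assumes f: "f \<in> carrier F"
    and A: "\<And>x y. x \<in> stabilizer G (\<triangleright>) f \<Longrightarrow> y \<in> stabilizer G (\<triangleright>) f \<Longrightarrow>
      \<tau> y x f * A (y \<otimes>\<^bsub>G\<^esub> x) = \<tau> x y f * A (x \<otimes>\<^bsub>G\<^esub> y)"
    and g: "g \<in> stabilizer G (\<triangleright>) f"
  shows "induce f A g f = of_nat (card (stabilizer G (\<triangleright>) f)) * A g"
proof -
  let ?S = "stabilizer G (\<triangleright>) f"
  interpret S: subgroup ?S G using f by (rule subgroup_stabilizer)
  have summand: "\<tau> (inv\<^bsub>G\<^esub> p \<otimes>\<^bsub>G\<^esub> g) p f / \<tau> p (inv\<^bsub>G\<^esub> p \<otimes>\<^bsub>G\<^esub> g) f * A (inv\<^bsub>G\<^esub> p \<otimes>\<^bsub>G\<^esub> g \<otimes>\<^bsub>G\<^esub> p) = A g"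
    if p: "p \<in> ?S" for p
  proof -
    let ?k = "inv\<^bsub>G\<^esub> p \<otimes>\<^bsub>G\<^esub> g"
    have k: "?k \<in> ?S" using p g by auto
    have pk: "p \<otimes>\<^bsub>G\<^esub> ?k = g"
      using p g by (simp add: G.m_assoc[symmetric])
    have eq: "\<tau> ?k p f * A (?k \<otimes>\<^bsub>G\<^esub> p) = \<tau> p ?k f * A g"
      using A[OF p k] unfolding pk .
    have "\<tau> p ?k f \<noteq> 0"
      using p k f by (intro tau_nonzero) auto
    then show ?thesis
      unfolding times_divide_eq_left eq by (rule nonzero_mult_div_cancel_left)
  qed
  have fixed: "g \<triangleright> f = f" "{p \<in> carrier G. p \<triangleright> f = f} = ?S"
    using g unfolding stabilizer_def by blast+
  have "induce f A g f = (\<Sum>p\<in>?S. \<tau> (inv\<^bsub>G\<^esub> p \<otimes>\<^bsub>G\<^esub> g) p f / \<tau> p (inv\<^bsub>G\<^esub> p \<otimes>\<^bsub>G\<^esub> g) f *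
      A (inv\<^bsub>G\<^esub> p \<otimes>\<^bsub>G\<^esub> g \<otimes>\<^bsub>G\<^esub> p))"
    unfolding induce_def fixed by simp
  also have "\<dots> = (\<Sum>p\<in>?S. A g)"
    by (rule sum.cong[OF refl summand])
  finally show ?thesis by simp
qed

end

section \<open>Cocommutative elements of the bismash product\<close>

context matched_pair_cocycles
begin

abbreviation H :: "('g \<times> 'f, 'k) hopf" where
  "H \<equiv> bismash G F (\<triangleleft>) (\<triangleright>) \<sigma> \<tau>"

lemma bismash_comul_coeff:
  assumes fin: "finite (carrier G)" and K: "finite K" "K \<subseteq> carrier G \<times> carrier F"
    and a: "a \<in> free_space K"
  shows "tcoeff (comul H a) (y, f') (x, f) =
    (if x \<in> carrier G \<and> y \<in> carrier G \<and> f' = x \<triangleright> f then \<tau> y x f * Poly_Mapping.lookup a (y \<otimes>\<^bsub>G\<^esub> x, f) else 0)"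
proof -
  let ?t = "\<lambda>g k. \<Sum>t\<in>carrier G. \<tau> (g \<otimes>\<^bsub>G\<^esub> inv\<^bsub>G\<^esub> t) t k * (Poly_Mapping.lookup (basis_vec (t, k)) (x, f) *
      Poly_Mapping.lookup (basis_vec (g \<otimes>\<^bsub>G\<^esub> inv\<^bsub>G\<^esub> t, t \<triangleright> k)) (y, f'))"
  have delta: "?t g k = (if (g, k) = (y \<otimes>\<^bsub>G\<^esub> x, f) \<and> x \<in> carrier G \<and> y \<in> carrier G \<and> f' = x \<triangleright> f
      then \<tau> y x f else 0)" if "g \<in> carrier G" for g k
  proof -
    have "?t g k = (\<Sum>t\<in>carrier G. if t = x then
        (if k = f \<and> g \<otimes>\<^bsub>G\<^esub> inv\<^bsub>G\<^esub> x = y \<and> x \<triangleright> f = f' then \<tau> y x f else 0) else 0)"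
      by (intro sum.cong refl) (auto simp: lookup_single when_def)
    also have "\<dots> = (if x \<in> carrier G then
        (if k = f \<and> g \<otimes>\<^bsub>G\<^esub> inv\<^bsub>G\<^esub> x = y \<and> x \<triangleright> f = f' then \<tau> y x f else 0) else 0)"
      using fin by (simp add: sum.delta')
    finally have sum: "?t g k = \<dots>" .
    show ?thesis
    proof (cases "x \<in> carrier G")
      case True
      then have "g \<otimes>\<^bsub>G\<^esub> inv\<^bsub>G\<^esub> x = y \<longleftrightarrow> y \<in> carrier G \<and> g = y \<otimes>\<^bsub>G\<^esub> x"
        using that by (metis G.inv_closed G.inv_solve_right' G.m_closed)
      then show ?thesis unfolding sum by auto
    next
      case False
      then show ?thesis unfolding sum by simp
    qed
  qed
  have "tcoeff (comul H a) (y, f') (x, f) = (\<Sum>u\<in>K. Poly_Mapping.lookup a u * ?t (fst u) (snd u))"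
    unfolding bismash_def coalg.simps lookup_linear_ext2[OF K(1) a]
    by (intro sum.cong refl) (simp add: lookup_sum case_prod_beta)
  also have "\<dots> = (\<Sum>u\<in>K. if u = (y \<otimes>\<^bsub>G\<^esub> x, f) then
      (if x \<in> carrier G \<and> y \<in> carrier G \<and> f' = x \<triangleright> f then \<tau> y x f * Poly_Mapping.lookup a (y \<otimes>\<^bsub>G\<^esub> x, f) else 0) else 0)"
  proof (rule sum.cong[OF refl])
    fix u assume "u \<in> K"
    then have "fst u \<in> carrier G" using K(2) by auto
    from delta[OF this, of "snd u"]
    show "Poly_Mapping.lookup a u * ?t (fst u) (snd u) = (if u = (y \<otimes>\<^bsub>G\<^esub> x, f) then
      (if x \<in> carrier G \<and> y \<in> carrier G \<and> f' = x \<triangleright> f then \<tau> y x f * Poly_Mapping.lookup a (y \<otimes>\<^bsub>G\<^esub> x, f) else 0) else 0)"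
      by (auto simp: mult.commute)
  qed
  also have "\<dots> = (if x \<in> carrier G \<and> y \<in> carrier G \<and> f' = x \<triangleright> f then \<tau> y x f * Poly_Mapping.lookup a (y \<otimes>\<^bsub>G\<^esub> x, f) else 0)"
    using K(1) free_space_lookup[OF a, of "(y \<otimes>\<^bsub>G\<^esub> x, f)"] by (simp add: sum.delta')
  finally show ?thesis .
qed

lemma bismash_mul_coeff:
  assumes K: "finite K" "a \<in> free_space K" and L: "finite L" "b \<in> free_space L"
  shows "Poly_Mapping.lookup (hmul H a b) w = (\<Sum>u\<in>K. \<Sum>v\<in>L.
    if fst u \<triangleleft> snd u = fst v \<and> w = (fst u, snd u \<otimes>\<^bsub>F\<^esub> snd v)
    then Poly_Mapping.lookup a u * Poly_Mapping.lookup b v * \<sigma> (fst u) (snd u) (snd v) else 0)"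
proof -
  have "Poly_Mapping.lookup (hmul H a b) w = (\<Sum>u\<in>K. Poly_Mapping.lookup a u *
      Poly_Mapping.lookup (linear_ext scale1 (\<lambda>(g', f'). if fst u \<triangleleft> snd u = g'
        then scale1 (\<sigma> (fst u) (snd u) f') (basis_vec (fst u, snd u \<otimes>\<^bsub>F\<^esub> f')) else 0) b) w)"
    unfolding bismash_def hopf.simps lookup_linear_ext1[OF K] case_prod_beta ..
  also have "\<dots> = (\<Sum>u\<in>K. \<Sum>v\<in>L.
    if fst u \<triangleleft> snd u = fst v \<and> w = (fst u, snd u \<otimes>\<^bsub>F\<^esub> snd v)
    then Poly_Mapping.lookup a u * Poly_Mapping.lookup b v * \<sigma> (fst u) (snd u) (snd v) else 0)"
    unfolding lookup_linear_ext1[OF L] sum_distrib_left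
    by (intro sum.cong refl) (auto simp: case_prod_beta lookup_single when_def)
  finally show ?thesis .
qed

definition class_element :: "'f set \<Rightarrow> ('g \<Rightarrow> 'f \<Rightarrow> 'k) \<Rightarrow> ('g \<times> 'f \<Rightarrow>\<^sub>0 'k)" where
  "class_element \<Omega> X = (\<Sum>u\<in>carrier G \<times> \<Omega>. scale1 (X (fst u) (snd u)) (basis_vec u))"

lemma lookup_class_element:
  assumes "finite (carrier G)" "finite \<Omega>"
  shows "Poly_Mapping.lookup (class_element \<Omega> X) (g, f) = (if g \<in> carrier G \<and> f \<in> \<Omega> then X g f else 0)"
  unfolding class_element_def using assms by (simp add: lookup_combination)

lemma class_element_in_free_space:
  assumes "finite (carrier G)" "finite \<Omega>"
  shows "class_element \<Omega> X \<in> free_space (carrier G \<times> \<Omega>)"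
  unfolding class_element_def using assms by (intro combination_in_free_space) simp

lemma orbit_subcoalgebra:
  assumes fin: "finite (carrier G)" "finite \<Omega>" and \<Omega>: "\<Omega> \<subseteq> carrier F"
    and closed: "\<And>x f. x \<in> carrier G \<Longrightarrow> f \<in> \<Omega> \<Longrightarrow> x \<triangleright> f \<in> \<Omega>"
    and u: "u \<in> carrier G \<times> \<Omega>"
  shows "comul H (basis_vec u) \<in> tensor_space (free_space (carrier G \<times> \<Omega>)) (carrier G \<times> \<Omega>)"
proof (rule tensor_space_coeffI)
  fix p q assume nz: "tcoeff (comul H (basis_vec u)) p q \<noteq> 0"
  obtain y f' x f where pq: "p = (y, f')" "q = (x, f)" by (cases p, cases q)
  have e: "basis_vec u \<in> free_space {u}" by simp
  have "tcoeff (comul H (basis_vec u)) p q = (if x \<in> carrier G \<and> y \<in> carrier G \<and> f' = x \<triangleright> f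
      then \<tau> y x f * Poly_Mapping.lookup (basis_vec u) (y \<otimes>\<^bsub>G\<^esub> x, f) else 0)"
    unfolding pq using u \<Omega> by (intro bismash_comul_coeff[OF fin(1) _ _ e]) auto
  with nz have "x \<in> carrier G" "y \<in> carrier G" "f' = x \<triangleright> f" "u = (y \<otimes>\<^bsub>G\<^esub> x, f)"
    by (auto simp: lookup_single when_def split: if_splits)
  with u closed show "p \<in> carrier G \<times> \<Omega> \<and> q \<in> carrier G \<times> \<Omega>" by (auto simp: pq)
qed

text \<open>
  The coefficient of \<open>(p\<^sub>y # f') \<otimes> (p\<^sub>x # f)\<close> can be nonzero only if \<open>f' = x \<triangleright> f\<close> and \<open>y x\<close>
  fixes \<open>f\<close>. This condition is symmetric under the exchange of the tensor factors, and where it holds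
  the two coefficients agree by the trace property of \<open>X\<close>.
\<close>

lemma class_element_cocommutative:
  assumes fin: "finite (carrier G)" "finite \<Omega>" and \<Omega>: "\<Omega> \<subseteq> carrier F"
    and closed: "\<And>x f. x \<in> carrier G \<Longrightarrow> f \<in> \<Omega> \<Longrightarrow> x \<triangleright> f \<in> \<Omega>"
    and X: "twisted_class_function \<Omega> X"
  shows "cocommutative H (class_element \<Omega> X)"
proof -
  have coeff: "tcoeff (comul H (class_element \<Omega> X)) (y, f') (x, f) =
      (if x \<in> carrier G \<and> y \<in> carrier G \<and> f \<in> \<Omega> \<and> f' = x \<triangleright> f then \<tau> y x f * X (y \<otimes>\<^bsub>G\<^esub> x) f else 0)"
    for x y f f'
  proof -
    have "carrier G \<times> \<Omega> \<subseteq> carrier G \<times> carrier F" using \<Omega> by auto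
    then show ?thesis
      using fin by (subst bismash_comul_coeff[OF fin(1) _ _ class_element_in_free_space[OF fin]])
        (auto simp: lookup_class_element)
  qed
  have support: "\<tau> y x f * X (y \<otimes>\<^bsub>G\<^esub> x) f = 0"
    if "x \<in> carrier G" "y \<in> carrier G" "f \<in> \<Omega>" "y \<triangleright> (x \<triangleright> f) \<noteq> f" for x y f
  proof -
    have "(y \<otimes>\<^bsub>G\<^esub> x) \<triangleright> f \<noteq> f"
      using that \<Omega> by (auto simp: lact_mult)
    then show ?thesis using X that unfolding twisted_class_function_def by simp
  qed
  let ?loop = "\<lambda>x y f f'. x \<in> carrier G \<and> y \<in> carrier G \<and> f \<in> \<Omega> \<and> f' \<in> \<Omega> \<and> f' = x \<triangleright> f \<and> f = y \<triangleright> f'"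
  have no_loop: "tcoeff (comul H (class_element \<Omega> X)) (y, f') (x, f) = 0" if "\<not> ?loop x y f f'" for x y f f'
  proof (cases "x \<in> carrier G \<and> y \<in> carrier G \<and> f \<in> \<Omega> \<and> f' = x \<triangleright> f")
    case True
    then have "y \<triangleright> (x \<triangleright> f) \<noteq> f" using that closed by metis
    then show ?thesis using True support[of x y f] by (simp add: coeff)
  next
    case False
    then show ?thesis by (simp only: coeff if_False)
  qed
  have "tcoeff (comul H (class_element \<Omega> X)) (y, f') (x, f) = tcoeff (comul H (class_element \<Omega> X)) (x, f) (y, f')"
    for x y f f'
  proof (cases "?loop x y f f'")
    case True
    then have "\<tau> y x f * X (y \<otimes>\<^bsub>G\<^esub> x) f = \<tau> x y f' * X (x \<otimes>\<^bsub>G\<^esub> y) f'"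
      using X unfolding twisted_class_function_def by metis
    moreover have "tcoeff (comul H (class_element \<Omega> X)) (y, f') (x, f) = \<tau> y x f * X (y \<otimes>\<^bsub>G\<^esub> x) f"
      unfolding coeff by (rule if_P) (use True in blast)
    moreover have "tcoeff (comul H (class_element \<Omega> X)) (x, f) (y, f') = \<tau> x y f' * X (x \<otimes>\<^bsub>G\<^esub> y) f'"
      unfolding coeff by (rule if_P) (use True in blast)
    ultimately show ?thesis by (simp only:)
  next
    case False
    then have "\<not> ?loop y x f' f" by blast
    from no_loop[OF False] no_loop[OF this] show ?thesis by (rule trans[OF _ sym])
  qed
  then show ?thesis unfolding cocommutative_def by auto
qed

text \<open>
  A product with an element supported on the vectors \<open>p\<^sub>h # 1\<close> involves only values of \<open>\<sigma>\<close> with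
  the unit of \<open>F\<close> among the arguments, which are \<open>1\<close>. The right action enters only if this element is the right factor.
\<close>

lemma class_element_times_unit_row:
  assumes fin: "finite (carrier G)" "finite \<Omega>" and \<Omega>: "\<Omega> \<subseteq> carrier F"
    and h: "h \<in> carrier G" "f \<in> \<Omega>"
  shows "Poly_Mapping.lookup (hmul H (class_element \<Omega> X) (class_element {\<one>\<^bsub>F\<^esub>} Y)) (h, f) =
    X h f * Y (h \<triangleleft> f) \<one>\<^bsub>F\<^esub>"
proof -
  let ?K = "carrier G \<times> \<Omega>" and ?L = "carrier G \<times> {\<one>\<^bsub>F\<^esub>}"
  have "Poly_Mapping.lookup (hmul H (class_element \<Omega> X) (class_element {\<one>\<^bsub>F\<^esub>} Y)) (h, f) =
      (\<Sum>u\<in>?K. \<Sum>v\<in>?L. if v = (h \<triangleleft> f, \<one>\<^bsub>F\<^esub>) then if u = (h, f) then X h f * Y (h \<triangleleft> f) \<one>\<^bsub>F\<^esub> else 0 else 0)"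
  proof (subst bismash_mul_coeff[where K = ?K and L = ?L])
    show "finite ?K" "finite ?L" using fin by auto
    show "(\<Sum>u\<in>?K. \<Sum>v\<in>?L. if fst u \<triangleleft> snd u = fst v \<and> (h, f) = (fst u, snd u \<otimes>\<^bsub>F\<^esub> snd v)
        then Poly_Mapping.lookup (class_element \<Omega> X) u * Poly_Mapping.lookup (class_element {\<one>\<^bsub>F\<^esub>} Y) v *
          \<sigma> (fst u) (snd u) (snd v) else 0) =
      (\<Sum>u\<in>?K. \<Sum>v\<in>?L. if v = (h \<triangleleft> f, \<one>\<^bsub>F\<^esub>) then if u = (h, f) then X h f * Y (h \<triangleleft> f) \<one>\<^bsub>F\<^esub> else 0 else 0)"
    proof (rule sum.cong[OF refl], rule sum.cong[OF refl])
      fix u v assume "u \<in> ?K" "v \<in> ?L"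
      then obtain g k g' where uv: "u = (g, k)" "v = (g', \<one>\<^bsub>F\<^esub>)" "g \<in> carrier G" "g' \<in> carrier G"
        "k \<in> \<Omega>" "k \<in> carrier F"
        using \<Omega> by blast
      then show "(if fst u \<triangleleft> snd u = fst v \<and> (h, f) = (fst u, snd u \<otimes>\<^bsub>F\<^esub> snd v)
        then Poly_Mapping.lookup (class_element \<Omega> X) u * Poly_Mapping.lookup (class_element {\<one>\<^bsub>F\<^esub>} Y) v *
          \<sigma> (fst u) (snd u) (snd v) else 0) = (if v = (h \<triangleleft> f, \<one>\<^bsub>F\<^esub>) then if u = (h, f) then X h f * Y (h \<triangleleft> f) \<one>\<^bsub>F\<^esub> else 0 else 0)"
      proof -
        have cond: "g \<triangleleft> k = g' \<and> (h, f) = (g, k \<otimes>\<^bsub>F\<^esub> \<one>\<^bsub>F\<^esub>) \<longleftrightarrow> g = h \<and> k = f \<and> g' = h \<triangleleft> f"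
          using F.r_one[OF uv(6)] by auto
        have coeffs: "Poly_Mapping.lookup (class_element \<Omega> X) (g, k) = X g k"
            "Poly_Mapping.lookup (class_element {\<one>\<^bsub>F\<^esub>} Y) (g', \<one>\<^bsub>F\<^esub>) = Y g' \<one>\<^bsub>F\<^esub>"
          using fin uv(3-5) by (simp_all add: lookup_class_element)
        show ?thesis
          unfolding uv(1,2) fst_conv snd_conv cond coeffs sigma_one2[OF uv(3,6)] by auto
      qed
    qed
  qed (use fin in \<open>auto intro: class_element_in_free_space\<close>)
  also have "\<dots> = X h f * Y (h \<triangleleft> f) \<one>\<^bsub>F\<^esub>"
    using fin h \<Omega> by (simp add: sum.delta' sum.delta ract_closed subset_iff)
  finally show ?thesis .
qed

lemma unit_row_times_class_element:
  assumes fin: "finite (carrier G)" "finite \<Omega>" and \<Omega>: "\<Omega> \<subseteq> carrier F"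
    and h: "h \<in> carrier G" "f \<in> \<Omega>"
  shows "Poly_Mapping.lookup (hmul H (class_element {\<one>\<^bsub>F\<^esub>} Y) (class_element \<Omega> X)) (h, f) =
    Y h \<one>\<^bsub>F\<^esub> * X h f"
proof -
  let ?K = "carrier G \<times> {\<one>\<^bsub>F\<^esub>}" and ?L = "carrier G \<times> \<Omega>"
  have "Poly_Mapping.lookup (hmul H (class_element {\<one>\<^bsub>F\<^esub>} Y) (class_element \<Omega> X)) (h, f) =
      (\<Sum>u\<in>?K. \<Sum>v\<in>?L. if v = (h, f) then if u = (h, \<one>\<^bsub>F\<^esub>) then Y h \<one>\<^bsub>F\<^esub> * X h f else 0 else 0)"
  proof (subst bismash_mul_coeff[where K = ?K and L = ?L])
    show "finite ?K" "finite ?L" using fin by auto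
    show "(\<Sum>u\<in>?K. \<Sum>v\<in>?L. if fst u \<triangleleft> snd u = fst v \<and> (h, f) = (fst u, snd u \<otimes>\<^bsub>F\<^esub> snd v)
        then Poly_Mapping.lookup (class_element {\<one>\<^bsub>F\<^esub>} Y) u * Poly_Mapping.lookup (class_element \<Omega> X) v *
          \<sigma> (fst u) (snd u) (snd v) else 0) =
      (\<Sum>u\<in>?K. \<Sum>v\<in>?L. if v = (h, f) then if u = (h, \<one>\<^bsub>F\<^esub>) then Y h \<one>\<^bsub>F\<^esub> * X h f else 0 else 0)"
    proof (rule sum.cong[OF refl], rule sum.cong[OF refl])
      fix u v assume "u \<in> ?K" "v \<in> ?L"
      then obtain g g' k where "u = (g, \<one>\<^bsub>F\<^esub>)" "v = (g', k)" "g \<in> carrier G" "g' \<in> carrier G"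
        "k \<in> \<Omega>" "k \<in> carrier F"
        using \<Omega> by blast
      then show "(if fst u \<triangleleft> snd u = fst v \<and> (h, f) = (fst u, snd u \<otimes>\<^bsub>F\<^esub> snd v)
        then Poly_Mapping.lookup (class_element {\<one>\<^bsub>F\<^esub>} Y) u * Poly_Mapping.lookup (class_element \<Omega> X) v *
          \<sigma> (fst u) (snd u) (snd v) else 0) = (if v = (h, f) then if u = (h, \<one>\<^bsub>F\<^esub>) then Y h \<one>\<^bsub>F\<^esub> * X h f else 0 else 0)"
        using fin by (auto simp: lookup_class_element sigma_one1 sigma_one2 ract_one)
    qed
  qed (use fin in \<open>auto intro: class_element_in_free_space\<close>)
  also have "\<dots> = Y h \<one>\<^bsub>F\<^esub> * X h f"
    using fin h by (simp add: sum.delta' sum.delta)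
  finally show ?thesis .
qed

end

section \<open>Comparison of the two products\<close>

context matched_pair_cocycles
begin

text \<open>
  The trace property of the induced function for the arrows \<open>z\<inverse>\<close> and \<open>g z\<close> relates its values at the
  loops \<open>g\<close> and \<open>z\<inverse> g z\<close>.
\<close>

lemma induce_conjugate:
  assumes f: "f \<in> carrier F"
    and A: "\<And>x y. x \<in> stabilizer G (\<triangleright>) f \<Longrightarrow> y \<in> stabilizer G (\<triangleright>) f \<Longrightarrow>
      \<tau> y x f * A (y \<otimes>\<^bsub>G\<^esub> x) = \<tau> x y f * A (x \<otimes>\<^bsub>G\<^esub> y)"
    and g: "g \<in> stabilizer G (\<triangleright>) f" and z: "z \<in> carrier G"
    and card: "of_nat (card (stabilizer G (\<triangleright>) f)) \<noteq> (0::'k)"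
  obtains c where "c \<noteq> 0"
    "induce f A (inv\<^bsub>G\<^esub> z \<otimes>\<^bsub>G\<^esub> g \<otimes>\<^bsub>G\<^esub> z) (inv\<^bsub>G\<^esub> z \<triangleright> f) = c * A g"
proof -
  let ?x = "inv\<^bsub>G\<^esub> z" and ?y = "g \<otimes>\<^bsub>G\<^esub> z"
  let ?s = "\<tau> ?y ?x f" and ?t = "\<tau> ?x ?y (?x \<triangleright> f)" and ?n = "of_nat (card (stabilizer G (\<triangleright>) f)) :: 'k"
  have gG: "g \<in> carrier G" "g \<triangleright> f = f" using g by (auto simp: stabilizer_def)
  have x: "?x \<in> carrier G" and y: "?y \<in> carrier G" using gG z by auto
  have nz: "?s \<noteq> 0" "?t \<noteq> 0" using tau_nonzero[OF y x f] tau_nonzero[OF x y lact_closed[OF x f]] .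
  have "?y \<triangleright> (?x \<triangleright> f) = f"
    using lact_inv[OF x f] z gG x f by (simp add: lact_mult lact_closed)
  then have "?s * induce f A (?y \<otimes>\<^bsub>G\<^esub> ?x) f = ?t * induce f A (?x \<otimes>\<^bsub>G\<^esub> ?y) (?x \<triangleright> f)"
    using twisted_class_function_induce[OF f, of A] x y f unfolding twisted_class_function_def by blast
  moreover have "?y \<otimes>\<^bsub>G\<^esub> ?x = g" "?x \<otimes>\<^bsub>G\<^esub> ?y = ?x \<otimes>\<^bsub>G\<^esub> g \<otimes>\<^bsub>G\<^esub> z"
    using gG z by (simp_all add: G.m_assoc)
  ultimately have eq: "?s * (?n * A g) = ?t * induce f A (?x \<otimes>\<^bsub>G\<^esub> g \<otimes>\<^bsub>G\<^esub> z) (?x \<triangleright> f)"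
    using induce_at_base[OF f A g] by simp
  show ?thesis
  proof (rule that)
    show "?s * ?n / ?t \<noteq> 0" using nz card by simp
    show "induce f A (?x \<otimes>\<^bsub>G\<^esub> g \<otimes>\<^bsub>G\<^esub> z) (?x \<triangleright> f) = ?s * ?n / ?t * A g"
      unfolding times_divide_eq_left mult.assoc eq by (rule nonzero_mult_div_cancel_left[OF nz(2), symmetric])
  qed
qed

text \<open>
  Two cocommutative elements are multiplied in both orders: the one supported on the orbit of
  \<open>f\<close> that is built from the function induced by \<open>A\<close>, and the one supported on the unit of \<open>F\<close> that
  is built from \<open>B\<close>. The orbit and the unit together span a finite subcoalgebra.
\<close>

lemma trace_identity:
  assumes fin: "finite (carrier G)" and H: "coquasitriangular H" and f: "f \<in> carrier F"
    and A: "\<And>x y. x \<in> stabilizer G (\<triangleright>) f \<Longrightarrow> y \<in> stabilizer G (\<triangleright>) f \<Longrightarrow>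
      \<tau> y x f * A (y \<otimes>\<^bsub>G\<^esub> x) = \<tau> x y f * A (x \<otimes>\<^bsub>G\<^esub> y)"
    and B: "\<And>x y. x \<in> carrier G \<Longrightarrow> y \<in> carrier G \<Longrightarrow> B (y \<otimes>\<^bsub>G\<^esub> x) = B (x \<otimes>\<^bsub>G\<^esub> y)"
    and card: "of_nat (card (stabilizer G (\<triangleright>) f)) \<noteq> (0::'k)"
    and g: "g \<in> stabilizer G (\<triangleright>) f" and z: "z \<in> carrier G"
  shows "A g * B ((inv\<^bsub>G\<^esub> z \<otimes>\<^bsub>G\<^esub> g \<otimes>\<^bsub>G\<^esub> z) \<triangleleft> (inv\<^bsub>G\<^esub> z \<triangleright> f)) =
    A g * B (inv\<^bsub>G\<^esub> z \<otimes>\<^bsub>G\<^esub> g \<otimes>\<^bsub>G\<^esub> z)"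
proof -
  define \<Omega> where "\<Omega> = (\<lambda>x. x \<triangleright> f) ` carrier G"
  let ?U = "{\<one>\<^bsub>F\<^esub>}"
  let ?X = "induce f A" and ?Y = "\<lambda>h _. B h"
  let ?K = "carrier G \<times> (\<Omega> \<union> ?U)"
  let ?h = "inv\<^bsub>G\<^esub> z \<otimes>\<^bsub>G\<^esub> g \<otimes>\<^bsub>G\<^esub> z" and ?f = "inv\<^bsub>G\<^esub> z \<triangleright> f"
  have fin\<Omega>: "finite \<Omega>" using fin by (simp add: \<Omega>_def)
  have \<Omega>F: "\<Omega> \<subseteq> carrier F" using f by (auto simp: \<Omega>_def lact_closed)
  have \<Omega>_closed: "x \<triangleright> k \<in> \<Omega>" if "x \<in> carrier G" "k \<in> \<Omega>" for x k
  proof -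
    obtain p where "p \<in> carrier G" "k = p \<triangleright> f" using \<open>k \<in> \<Omega>\<close> by (auto simp: \<Omega>_def)
    then have "x \<triangleright> k = (x \<otimes>\<^bsub>G\<^esub> p) \<triangleright> f" "x \<otimes>\<^bsub>G\<^esub> p \<in> carrier G"
      using that f by (simp_all add: lact_mult)
    then show ?thesis by (auto simp: \<Omega>_def)
  qed
  have U_closed: "x \<triangleright> k \<in> ?U" if "x \<in> carrier G" "k \<in> ?U" for x k
    using that by (simp add: lact_unit)
  have "twisted_class_function \<Omega> ?X"
    using twisted_class_function_induce[OF f, of A] \<Omega>F unfolding twisted_class_function_def by blast
  then have cocomm_X: "cocommutative H (class_element \<Omega> ?X)"
    by (intro class_element_cocommutative fin fin\<Omega> \<Omega>F \<Omega>_closed)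
  have "twisted_class_function ?U ?Y"
    unfolding twisted_class_function_def by (auto simp: lact_unit tau_one3 B)
  then have cocomm_Y: "cocommutative H (class_element ?U ?Y)"
    by (intro class_element_cocommutative fin U_closed) auto
  have comm: "hmul H (class_element \<Omega> ?X) (class_element ?U ?Y) = hmul H (class_element ?U ?Y) (class_element \<Omega> ?X)"
  proof (rule cocommutative_elements_commute[OF H _ _ _ _ cocomm_X _ cocomm_Y])
    show "finite ?K" using fin fin\<Omega> by simp
    show "?K \<subseteq> cbasis H" using \<Omega>F by (auto simp: bismash_def)
    show "comul H (basis_vec u) \<in> tensor_space (free_space ?K) ?K" if "u \<in> ?K" for u
      using that fin fin\<Omega> \<Omega>F \<Omega>_closed U_closed by (intro orbit_subcoalgebra) auto
    show "class_element \<Omega> ?X \<in> free_space ?K"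
      by (rule free_space_mono[OF class_element_in_free_space[OF fin fin\<Omega>]]) auto
    show "class_element ?U ?Y \<in> free_space ?K"
      by (rule free_space_mono[OF class_element_in_free_space[OF fin]]) auto
  qed
  have gG: "g \<in> carrier G" using g by (simp add: stabilizer_def)
  have h: "?h \<in> carrier G" and f': "?f \<in> \<Omega>" using gG z by (auto simp: \<Omega>_def)
  obtain c where c: "c \<noteq> 0" "?X ?h ?f = c * A g"
    using induce_conjugate[OF f A g z card] by blast
  have "?X ?h ?f * B (?h \<triangleleft> ?f) = B ?h * ?X ?h ?f"
    using class_element_times_unit_row[OF fin fin\<Omega> \<Omega>F h f', of ?X ?Y]
      unit_row_times_class_element[OF fin fin\<Omega> \<Omega>F h f', of ?Y ?X] unfolding comm by (rule trans[OF sym])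
  then have "c * (A g * B (?h \<triangleleft> ?f)) = c * (A g * B ?h)"
    unfolding c(2) by (simp only: mult_ac)
  then show ?thesis using c(1) by (metis mult_cancel_left)
qed

end

theorem theorem1p2:
  fixes G :: "('g, 'p) monoid_scheme" and F :: "('f, 'q) monoid_scheme"
    and ract :: "'g \<Rightarrow> 'f \<Rightarrow> 'g" and lact :: "'g \<Rightarrow> 'f \<Rightarrow> 'f"
    and \<sigma> :: "'g \<Rightarrow> 'f \<Rightarrow> 'f \<Rightarrow> 'k::{alg_closed_field, field_char_0}"
    and \<tau> :: "'g \<Rightarrow> 'g \<Rightarrow> 'f \<Rightarrow> 'k"
    and sV :: "'k \<Rightarrow> 'v::ab_group_add \<Rightarrow> 'v" and sW :: "'k \<Rightarrow> 'w::ab_group_add \<Rightarrow> 'w"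
    and v :: "nat \<Rightarrow> 'v" and w :: "nat \<Rightarrow> 'w"
    and a b :: "nat \<Rightarrow> nat \<Rightarrow> 'g \<Rightarrow> 'k"
  assumes "finite (carrier G)"
    and "matched_pair_cocycles G F ract lact \<sigma> \<tau>"
    and "coquasitriangular (bismash G F ract lact \<sigma> \<tau>)"
    and "f \<in> carrier F"
    and "right_coset_representatives G (stabilizer G lact f) T" and "\<one>\<^bsub>G\<^esub> \<in> T"
    and "simple_right_comodule (twisted_stabilizer_coalg G lact \<tau> f) sV V \<rho>V"
    and "V = module.span sV (v ` {1..m})"
    and "inj_on v {1..m}" and "\<not> module.dependent sV (v ` {1..m})"
    and "simple_right_comodule (function_coalg G :: ('g, 'k) coalg) sW W \<rho>W"
    and "W = module.span sW (w ` {1..n})"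
    and "inj_on w {1..n}" and "\<not> module.dependent sW (w ` {1..n})"
    and "\<forall>i\<in>{1..m}. \<rho>V (v i) =
      (\<Sum>l=1..m. tensor sV (v l) (\<Sum>g\<in>stabilizer G lact f. scale1 (a l i g) (basis_vec g)))"
    and "\<forall>j\<in>{1..n}. \<rho>W (w j) =
      (\<Sum>k=1..n. tensor sW (w k) (\<Sum>h\<in>carrier G. scale1 (b k j h) (basis_vec h)))"
  shows "\<forall>g\<in>stabilizer G lact f. \<forall>z\<in>T.
    (\<Sum>i=1..m. \<Sum>j=1..n. a i i g *
       b j j (ract (inv\<^bsub>G\<^esub> z \<otimes>\<^bsub>G\<^esub> g \<otimes>\<^bsub>G\<^esub> z) (lact (inv\<^bsub>G\<^esub> z) f))) =
    (\<Sum>i=1..m. \<Sum>j=1..n. a i i g * b j j (inv\<^bsub>G\<^esub> z \<otimes>\<^bsub>G\<^esub> g \<otimes>\<^bsub>G\<^esub> z))"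
proof (intro ballI)
  fix g z assume g: "g \<in> stabilizer G lact f" and "z \<in> T"
  interpret matched_pair_cocycles G F ract lact \<sigma> \<tau> by fact
  let ?S = "stabilizer G lact f"
  let ?A = "\<lambda>g. \<Sum>i=1..m. a i i g" and ?B = "\<lambda>h. \<Sum>j=1..n. b j j h"
  have z: "z \<in> carrier G"
    using \<open>z \<in> T\<close> assms(5) by (auto simp: right_coset_representatives_def)
  have S: "finite ?S" "subgroup ?S G"
    using assms(1,4) subgroup_stabilizer by (auto simp: stabilizer_def)
  have comV: "right_comodule (twisted_stabilizer_coalg G lact \<tau> f) sV V \<rho>V"
    using assms(7) by (simp add: simple_right_comodule_def)
  then interpret V: vector_space sV by (simp add: right_comodule_def)
  have A: "\<tau> y x f * ?A (y \<otimes>\<^bsub>G\<^esub> x) = \<tau> x y f * ?A (x \<otimes>\<^bsub>G\<^esub> y)" if "x \<in> ?S" "y \<in> ?S" for x y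
    using assms(15) V.span_superset[of "v ` {1..m}"] that
    by (intro G.comodule_trace_twisted[OF S comV _ assms(9,10)]) (auto simp: assms(8))
  \<comment> \<open>the second comodule is treated as one over the twisted coalgebra of the trivial action\<close>
  have SG: "stabilizer G (\<lambda>g x. x) f = carrier G"
    by (simp add: stabilizer_def)
  have comW: "right_comodule (twisted_stabilizer_coalg G (\<lambda>g x. x) (\<lambda>g h x. 1) f) sW W \<rho>W"
    using assms(11) by (simp add: simple_right_comodule_def function_coalg_eq_twisted[of G f])
  then interpret W: vector_space sW by (simp add: right_comodule_def)
  have B: "?B (y \<otimes>\<^bsub>G\<^esub> x) = ?B (x \<otimes>\<^bsub>G\<^esub> y)" if "x \<in> carrier G" "y \<in> carrier G" for x y
  proof -
    have "1 * ?B (y \<otimes>\<^bsub>G\<^esub> x) = 1 * ?B (x \<otimes>\<^bsub>G\<^esub> y)"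
      using assms(1,16) W.span_superset[of "w ` {1..n}"] that G.subgroup_self
      by (intro G.comodule_trace_twisted[OF _ _ comW _ assms(13,14)]) (auto simp: assms(12) SG)
    then show ?thesis by simp
  qed
  have card: "of_nat (card ?S) \<noteq> (0 :: 'k)"
    using S(1) g by auto
  show "(\<Sum>i=1..m. \<Sum>j=1..n. a i i g *
       b j j (ract (inv\<^bsub>G\<^esub> z \<otimes>\<^bsub>G\<^esub> g \<otimes>\<^bsub>G\<^esub> z) (lact (inv\<^bsub>G\<^esub> z) f))) =
    (\<Sum>i=1..m. \<Sum>j=1..n. a i i g * b j j (inv\<^bsub>G\<^esub> z \<otimes>\<^bsub>G\<^esub> g \<otimes>\<^bsub>G\<^esub> z))"
    using trace_identity[where A = ?A and B = ?B, OF assms(1,3,4) A B card g z] by (simp only: sum_product)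
qed

end
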